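(* Consider the known-template model, in which a reference configuration $\boldsymbol\theta^0=(\theta^0_1,\dots,\theta^0_N)$ is known up to a rigid rotation by $\Psi$ and the localized observations are $$\widetilde\theta_j=\theta_j^0+\Psi+\epsilon_j,\qquad \epsilon_j\sim\mathcal N(0,\sigma^2)\ \text{independent},\qquad j=1,\dots,N .$$ In this model the Fisher information and the Cram\'er--Rao bound are $$\mathcal I(\Psi)=\frac N{\sigma^2},\qquad \operatorname{Var}(\widehat\Psi)\ge\frac{\sigma^2}N .$$ The localized circular estimator $$\widehat\Psi_{\rm full}=\arg\!\left[\frac1N\sum_j\mathrm e^{\mathrm i(\widetilde\theta_j-\theta_j^0)}\right]$$ attains this bound to leading order. By contrast, compression to the ordinary order parameter, that is, use of the phase $\arg\widetilde Z$ of $\widetilde Z=\frac1N\sum_j\mathrm e^{\mathrm i\widetilde\theta_j}$, has asymptotic efficiency $$\eta_{\arg Z}:=\frac{\sigma^2/N}{\sigma^2q_2/(NR^2)}=\frac{R^2}{q_2}\le1 ,$$ where, for the noiseless configuration $\theta_j=\theta_j^0+\Psi$ with order parameter $Z=\frac1N\sum_j\mathrm e^{\mathrm i\theta_j}$, one sets $R=|Z|>0$ and $q_2=\frac1N\sum_j\cos^2(\theta_j-\arg Z)$.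
   Context: The quantity $\sigma^2q_2/(NR^2)$ is the leading term of the conditional mean-squared wrapped error of $\arg\widetilde Z$ about $\arg Z$, given the configuration $\boldsymbol\theta=(\theta_1,\dots,\theta_N)$, in the joint small-error regime $\sigma\ll1$ and $\sigma/(R\sqrt N)\ll1$. Here the wrapped error is the difference of the two angles reduced modulo $2\pi$ to the principal branch around $0$. The quantities $R$ and $q_2$ are unchanged by a rigid rotation of the configuration. The efficiency is the ratio of the Cram\'er--Rao value $\sigma^2/N$ to this leading-order mean-squared error. *)

theory Defs
  imports "HOL-Probability.Probability"
begin

definition noise_law :: "nat \<Rightarrow> real \<Rightarrow> (nat \<Rightarrow> real) measure" where
  "noise_law N \<sigma> = (\<Pi>\<^sub>M j\<in>{..<N}. density lborel (\<lambda>x. ennreal (normal_density 0 \<sigma> x)))"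

text \<open>Observations are real-valued lifts of the angles; they are not reduced modulo $2\pi$.\<close>

definition observation :: "nat \<Rightarrow> (nat \<Rightarrow> real) \<Rightarrow> real \<Rightarrow> (nat \<Rightarrow> real) \<Rightarrow> (nat \<Rightarrow> real)" where
  "observation N \<theta>0 \<Psi> \<epsilon> = (\<lambda>j\<in>{..<N}. \<theta>0 j + \<Psi> + \<epsilon> j)"

definition observation_law :: "nat \<Rightarrow> (nat \<Rightarrow> real) \<Rightarrow> real \<Rightarrow> real \<Rightarrow> (nat \<Rightarrow> real) measure" where
  "observation_law N \<theta>0 \<sigma> \<Psi> =
     distr (noise_law N \<sigma>) (\<Pi>\<^sub>M j\<in>{..<N}. lborel) (observation N \<theta>0 \<Psi>)"

definition likelihood :: "nat \<Rightarrow> (nat \<Rightarrow> real) \<Rightarrow> real \<Rightarrow> real \<Rightarrow> (nat \<Rightarrow> real) \<Rightarrow> real" where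
  "likelihood N \<theta>0 \<sigma> \<Psi> x = (\<Prod>j<N. normal_density (\<theta>0 j + \<Psi>) \<sigma> (x j))"

text \<open>Here \<open>f \<psi>\<close> has to be a density of \<open>P \<psi>\<close> with respect to a dominating measure
  that does not depend on \<open>\<psi>\<close>.\<close>

definition fisher_information ::
    "(real \<Rightarrow> 'a measure) \<Rightarrow> (real \<Rightarrow> 'a \<Rightarrow> real) \<Rightarrow> real \<Rightarrow> real" where
  "fisher_information P f \<psi> = (\<integral>x. (deriv (\<lambda>t. ln (f t x)) \<psi>)\<^sup>2 \<partial>P \<psi>)"

text \<open>Unbiasedness is only required for parameter values in some neighbourhood of \<open>\<psi>\<close>,
  which covers estimators that are unbiased on the whole line or on an open parameter interval.\<close>

definition unbiased_near :: "(real \<Rightarrow> 'a measure) \<Rightarrow> ('a \<Rightarrow> real) \<Rightarrow> real \<Rightarrow> bool" where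
  "unbiased_near P T \<psi> \<longleftrightarrow>
     (\<forall>\<^sub>F t in nhds \<psi>. integrable (P t) T \<and> (\<integral>x. T x \<partial>P t) = t)"

definition order_parameter :: "nat \<Rightarrow> (nat \<Rightarrow> real) \<Rightarrow> complex" where
  "order_parameter N \<theta> = (\<Sum>j<N. cis (\<theta> j)) / of_nat N"

definition R_of :: "nat \<Rightarrow> (nat \<Rightarrow> real) \<Rightarrow> real" where
  "R_of N \<theta> = cmod (order_parameter N \<theta>)"

definition q2_of :: "nat \<Rightarrow> (nat \<Rightarrow> real) \<Rightarrow> real" where
  "q2_of N \<theta> = (\<Sum>j<N. (cos (\<theta> j - Arg (order_parameter N \<theta>)))\<^sup>2) / real N"

definition full_estimator :: "nat \<Rightarrow> (nat \<Rightarrow> real) \<Rightarrow> (nat \<Rightarrow> real) \<Rightarrow> real" where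
  "full_estimator N \<theta>0 x = Arg (order_parameter N (\<lambda>j. x j - \<theta>0 j))"

text \<open>The representative in $(-\pi,\pi]$ of \<open>a - b\<close> modulo $2\pi$.\<close>

definition wrapped_error :: "real \<Rightarrow> real \<Rightarrow> real" where
  "wrapped_error a b = Arg (cis (a - b))"

definition wrapped_mse :: "'a measure \<Rightarrow> ('a \<Rightarrow> real) \<Rightarrow> real \<Rightarrow> real" where
  "wrapped_mse M T a = (\<integral>x. (wrapped_error (T x) a)\<^sup>2 \<partial>M)"

definition wrapped_variance :: "'a measure \<Rightarrow> ('a \<Rightarrow> real) \<Rightarrow> real \<Rightarrow> real" where
  "wrapped_variance M T a = prob_space.variance M (\<lambda>x. wrapped_error (T x) a)"

definition arg_Z_mse :: "nat \<Rightarrow> (nat \<Rightarrow> real) \<Rightarrow> real \<Rightarrow> real \<Rightarrow> real" where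
  "arg_Z_mse N \<theta>0 \<Psi> \<sigma> =
     wrapped_mse (observation_law N \<theta>0 \<sigma> \<Psi>) (\<lambda>x. Arg (order_parameter N x))
       (Arg (order_parameter N (\<lambda>j. \<theta>0 j + \<Psi>)))"

definition arg_Z_mse_leading :: "nat \<Rightarrow> (nat \<Rightarrow> real) \<Rightarrow> real \<Rightarrow> real" where
  "arg_Z_mse_leading N \<theta> \<sigma> = \<sigma>\<^sup>2 * q2_of N \<theta> / (real N * (R_of N \<theta>)\<^sup>2)"

definition arg_Z_efficiency :: "nat \<Rightarrow> (nat \<Rightarrow> real) \<Rightarrow> real \<Rightarrow> real" where
  "arg_Z_efficiency N \<theta> \<sigma> = (\<sigma>\<^sup>2 / real N) / arg_Z_mse_leading N \<theta> \<sigma>"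

end

theory Submission
  imports Defs
begin

text \<open>The Cramer-Rao bound comes from the Chapman-Robbins inequality: the squared likelihood ratio
  for a shift \<open>h\<close> is \<open>exp (N h\<^sup>2 / \<sigma>\<^sup>2)\<close> times the likelihood ratio for the shift \<open>2 h\<close>, so its mean
  is known exactly, and one lets \<open>h\<close> tend to \<open>0\<close> without differentiating under an integral.

  For the circular estimators, rotate \<open>Z\<close> to the positive real axis, put \<open>u j = \<theta> j - arg Z\<close> and
  \<open>m = E (cos (\<epsilon> j))\<close>, and write the rotated and rescaled noisy order parameter as \<open>(m + A) + \<i> B\<close>.
  Since \<open>\<Sum> cos (u j) = N R\<close> and \<open>\<Sum> sin (u j) = 0\<close>, both \<open>A\<close> and \<open>B\<close> are normalised sums of
  independent centred variables of size \<open>\<sigma>\<close>, hence their fourth moments are of order \<open>\<tau>\<^sup>2\<close> with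
  \<open>\<tau> = \<sigma>\<^sup>2 / (N R\<^sup>2)\<close>. A pointwise bound of the wrapped error minus \<open>B\<close> by fourth powers and the
  linearization of \<open>B\<close> in the noise then give a mean-squared deviation of order \<open>(\<tau> + \<sigma>\<^sup>2) \<tau>\<close>
  from the linear term, whose second moment is exactly \<open>\<tau> q2\<close>.\<close>

subsection \<open>Sums of independent variables and product measures\<close>

lemma power_le_one_plus_power4:
  fixes x :: real
  assumes "k \<le> 4"
  shows "\<bar>x ^ k\<bar> \<le> 1 + x ^ 4"
proof (cases "\<bar>x\<bar> \<le> 1")
  case True
  then have "\<bar>x ^ k\<bar> \<le> 1" by (simp add: power_abs power_le_one)
  moreover have "0 \<le> x ^ 4" by simp
  ultimately show ?thesis by linarith
next
  case False
  then have "\<bar>x\<bar> ^ k \<le> \<bar>x\<bar> ^ 4" using assms by (intro power_increasing) auto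
  then show ?thesis by (simp add: power_abs)
qed

lemma (in prob_space) integrable_power_le_4:
  fixes X :: "'a \<Rightarrow> real"
  assumes [measurable]: "random_variable borel X"
    and "integrable M (\<lambda>x. X x ^ 4)" "k \<le> 4"
  shows "integrable M (\<lambda>x. X x ^ k)"
proof (rule Bochner_Integration.integrable_bound[where f="\<lambda>x. 1 + X x ^ 4"])
  show "AE x in M. norm (X x ^ k) \<le> norm (1 + X x ^ 4)"
    using order_trans[OF power_le_one_plus_power4[OF assms(3)] abs_ge_self] by simp
qed (use assms in auto)

lemma (in prob_space) indep_var_power:
  fixes X Y :: "'a \<Rightarrow> real"
  assumes "indep_var borel X borel Y"
  shows "indep_var borel (\<lambda>x. X x ^ j) borel (\<lambda>x. Y x ^ k)"
  using indep_var_compose[OF assms, of "\<lambda>x. x ^ j" borel "\<lambda>x. x ^ k" borel] by (simp add: comp_def)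

text \<open>One induction proves all four facts, because the fourth moment of a longer sum needs the
  mean and the second moment of the shorter one. The constant 3, the Gaussian kurtosis, lets the
  bound reproduce itself: \<open>3 v^2 + 6 n v^2 + 3 n^2 v^2 = 3 ((n + 1) v)^2\<close>.\<close>

lemma (in prob_space) indep_sum_moments:
  fixes X :: "'i \<Rightarrow> 'a \<Rightarrow> real"
  assumes "finite I" "indep_vars (\<lambda>_. borel) X I"
    and "\<And>i. i \<in> I \<Longrightarrow> integrable M (\<lambda>x. X i x ^ 4)"
    and "\<And>i. i \<in> I \<Longrightarrow> expectation (X i) = 0"
  shows indep_sum_integrable_power4: "integrable M (\<lambda>x. (\<Sum>i\<in>I. X i x) ^ 4)" (is ?A)
    and indep_sum_expectation_zero: "expectation (\<lambda>x. \<Sum>i\<in>I. X i x) = 0" (is ?B)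
    and indep_sum_second_moment:
      "expectation (\<lambda>x. (\<Sum>i\<in>I. X i x)\<^sup>2) = (\<Sum>i\<in>I. expectation (\<lambda>x. (X i x)\<^sup>2))" (is ?C)
    and indep_sum_fourth_moment:
      "(\<And>i. i \<in> I \<Longrightarrow> expectation (\<lambda>x. (X i x)\<^sup>2) \<le> v) \<Longrightarrow>
       (\<And>i. i \<in> I \<Longrightarrow> expectation (\<lambda>x. X i x ^ 4) \<le> 3 * v\<^sup>2) \<Longrightarrow>
       expectation (\<lambda>x. (\<Sum>i\<in>I. X i x) ^ 4) \<le> 3 * (real (card I) * v)\<^sup>2"
proof -
  have *: "?A \<and> ?B \<and> ?C \<and> ((\<forall>i\<in>I. expectation (\<lambda>x. (X i x)\<^sup>2) \<le> v) \<longrightarrow>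
       (\<forall>i\<in>I. expectation (\<lambda>x. X i x ^ 4) \<le> 3 * v\<^sup>2) \<longrightarrow>
       expectation (\<lambda>x. (\<Sum>i\<in>I. X i x) ^ 4) \<le> 3 * (real (card I) * v)\<^sup>2)"
    using assms
  proof (induction I rule: finite_induct)
    case empty
    then show ?case by simp
  next
    case (insert i I)
    define S where "S = (\<lambda>x. \<Sum>i\<in>I. X i x)"
    have rv[measurable]: "random_variable borel (X j)" if "j \<in> insert i I" for j
      using insert.prems(1) that unfolding indep_vars_def by auto
    have [measurable]: "random_variable borel (X i)" by (rule rv) simp
    have [measurable]: "random_variable borel S"
      unfolding S_def by (intro borel_measurable_sum rv) auto
    have IH: "integrable M (\<lambda>x. S x ^ 4)" "expectation S = 0"
      "expectation (\<lambda>x. (S x)\<^sup>2) = (\<Sum>i\<in>I. expectation (\<lambda>x. (X i x)\<^sup>2))"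
      "(\<forall>i\<in>I. expectation (\<lambda>x. (X i x)\<^sup>2) \<le> v) \<Longrightarrow>
       (\<forall>i\<in>I. expectation (\<lambda>x. X i x ^ 4) \<le> 3 * v\<^sup>2) \<Longrightarrow>
       expectation (\<lambda>x. S x ^ 4) \<le> 3 * (real (card I) * v)\<^sup>2"
      using insert.IH indep_vars_subset[OF insert.prems(1)] insert.prems(2,3)
      unfolding S_def by auto
    have ind: "indep_var borel (X i) borel S"
      unfolding S_def using indep_vars_sum[OF insert.hyps insert.prems(1)] .
    have iX: "integrable M (\<lambda>x. X i x ^ k)" if "k \<le> 4" for k
      by (rule integrable_power_le_4) (use insert.prems(2)[of i] that in auto)
    have iS: "integrable M (\<lambda>x. S x ^ k)" if "k \<le> 4" for k
      by (rule integrable_power_le_4) (use IH(1) that in auto)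
    have iXS: "integrable M (\<lambda>x. X i x ^ j * S x ^ k)" if "j \<le> 4" "k \<le> 4" for j k
      using indep_var_integrable[OF indep_var_power[OF ind] iX[OF that(1)] iS[OF that(2)]] .
    have eXS: "expectation (\<lambda>x. X i x ^ j * S x ^ k)
        = expectation (\<lambda>x. X i x ^ j) * expectation (\<lambda>x. S x ^ k)"
      if "j \<le> 4" "k \<le> 4" for j k
      using indep_var_lebesgue_integral[OF indep_var_power[OF ind] iX[OF that(1)] iS[OF that(2)]] .
    have eX: "expectation (X i) = 0" using insert.prems(3) by simp
    have sum_eq: "(\<Sum>j\<in>insert i I. X j x) = X i x + S x" for x
      using insert.hyps by (simp add: S_def)
    \<comment> \<open>The exponents 1 stay explicit so that every mixed term matches
      \<open>iXS\<close> and \<open>eXS\<close>.\<close>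
    have p4: "(X i x + S x) ^ 4 = X i x ^ 4 + 4 * (X i x ^ 3 * S x ^ 1)
       + 6 * (X i x ^ 2 * S x ^ 2) + 4 * (X i x ^ 1 * S x ^ 3) + S x ^ 4" for x
      by (simp add: power4_eq_xxxx power3_eq_cube power2_eq_square algebra_simps)
    have p2: "(X i x + S x) ^ 2 = X i x ^ 2 + 2 * (X i x ^ 1 * S x ^ 1) + S x ^ 2" for x
      by (simp add: power2_eq_square algebra_simps)
    have A: "integrable M (\<lambda>x. (X i x + S x) ^ 4)"
      unfolding p4 by (intro Bochner_Integration.integrable_add integrable_mult_right iXS iX iS) auto
    have B: "expectation (\<lambda>x. X i x + S x) = 0"
      using iX[of 1] iS[of 1] eX IH(2) by (simp add: Bochner_Integration.integral_add)
    have C: "expectation (\<lambda>x. (X i x + S x)\<^sup>2)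
        = expectation (\<lambda>x. (X i x)\<^sup>2) + expectation (\<lambda>x. (S x)\<^sup>2)"
      unfolding p2 using iXS[of 1 1] iX[of 2] iS[of 2] eXS[of 1 1] eX by simp
    \<comment> \<open>By independence the mixed terms factor, and those containing a first power of
      \<open>X i\<close> or of \<open>S\<close> vanish since both means are zero.\<close>
    have D: "expectation (\<lambda>x. (X i x + S x) ^ 4) = expectation (\<lambda>x. X i x ^ 4)
        + 6 * (expectation (\<lambda>x. (X i x)\<^sup>2) * expectation (\<lambda>x. (S x)\<^sup>2)) + expectation (\<lambda>x. S x ^ 4)"
      unfolding p4 using iXS[of 3 1] iXS[of 2 2] iXS[of 1 3] iX[of 4] iS[of 4]
        eXS[of 3 1] eXS[of 2 2] eXS[of 1 3] eX IH(2) by simp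
    have card: "real (card (insert i I)) = real (card I) + 1" using insert.hyps by simp
    have E: "expectation (\<lambda>x. (X i x + S x) ^ 4) \<le> 3 * (real (card (insert i I)) * v)\<^sup>2"
      if v: "\<forall>i\<in>insert i I. expectation (\<lambda>x. (X i x)\<^sup>2) \<le> v"
        "\<forall>i\<in>insert i I. expectation (\<lambda>x. X i x ^ 4) \<le> 3 * v\<^sup>2"
    proof -
      have "expectation (\<lambda>x. (S x)\<^sup>2) \<le> real (card I) * v"
        unfolding IH(3) using v(1) by (intro sum_bounded_above) auto
      moreover have "0 \<le> expectation (\<lambda>x. (S x)\<^sup>2)" by (intro Bochner_Integration.integral_nonneg) simp
      moreover have "expectation (\<lambda>x. (X i x)\<^sup>2) \<le> v" using v by simp
      moreover have "0 \<le> expectation (\<lambda>x. (X i x)\<^sup>2)" by (intro Bochner_Integration.integral_nonneg) simp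
      ultimately have "expectation (\<lambda>x. (X i x)\<^sup>2) * expectation (\<lambda>x. (S x)\<^sup>2)
          \<le> v * (real (card I) * v)" by (intro mult_mono) linarith+
      moreover have "expectation (\<lambda>x. S x ^ 4) \<le> 3 * (real (card I) * v)\<^sup>2"
        by (rule IH(4)) (use v in blast)+
      moreover have "expectation (\<lambda>x. X i x ^ 4) \<le> 3 * v\<^sup>2" using v by simp
      moreover have "3 * ((real (card I) + 1) * v)\<^sup>2
          = 3 * v\<^sup>2 + 6 * (v * (real (card I) * v)) + 3 * (real (card I) * v)\<^sup>2"
        by (simp add: power2_eq_square algebra_simps)
      ultimately show ?thesis
        unfolding D card by linarith
    qed
    have C': "expectation (\<lambda>x. (X i x + S x)\<^sup>2) = (\<Sum>j\<in>insert i I. expectation (\<lambda>x. (X j x)\<^sup>2))"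
      unfolding C IH(3) using insert.hyps by simp
    show ?case
      unfolding sum_eq using A B C' E by blast
  qed
  show ?A ?B ?C using * by blast+
  show "expectation (\<lambda>x. (\<Sum>i\<in>I. X i x) ^ 4) \<le> 3 * (real (card I) * v)\<^sup>2"
    if "\<And>i. i \<in> I \<Longrightarrow> expectation (\<lambda>x. (X i x)\<^sup>2) \<le> v"
       "\<And>i. i \<in> I \<Longrightarrow> expectation (\<lambda>x. X i x ^ 4) \<le> 3 * v\<^sup>2"
    using * that by blast
qed

text \<open>Independence amounts to the joint law being the product of the marginals, and the joint
  map of all coordinates is the identity on extensional functions.\<close>

lemma indep_vars_PiM_coordinates:
  assumes "I \<noteq> {}" "finite I" "\<And>i. i \<in> I \<Longrightarrow> prob_space (M i)"
  shows "prob_space.indep_vars (PiM I M) M (\<lambda>i \<omega>. \<omega> i) I"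
proof -
  interpret prob_space "PiM I M" using assms by (intro prob_space_PiM)
  have "distr (PiM I M) (PiM I M) (\<lambda>\<omega>. \<lambda>i\<in>I. \<omega> i) = distr (PiM I M) (PiM I M) (\<lambda>\<omega>. \<omega>)"
    by (intro distr_cong) (auto simp: space_PiM)
  also have "\<dots> = PiM I M" by (rule distr_id)
  also have "\<dots> = PiM I (\<lambda>i. distr (PiM I M) (M i) (\<lambda>\<omega>. \<omega> i))"
    using assms by (intro PiM_cong distr_PiM_component[symmetric]) auto
  finally show ?thesis
    using assms(1) by (subst indep_vars_iff_distr_eq_PiM') auto
qed

text \<open>Coordinatewise images of independent coordinates are independent, so their joint law is
  again a product. This is applied to the shift of each noise coordinate by its noiseless
  angle.\<close>

lemma distr_PiM_coordinatewise:
  assumes I: "I \<noteq> {}" "finite I" and M: "\<And>i. i \<in> I \<Longrightarrow> prob_space (M i)"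
    and f: "\<And>i. i \<in> I \<Longrightarrow> f i \<in> measurable (M i) (M' i)"
  shows "distr (PiM I M) (PiM I M') (\<lambda>\<omega>. \<lambda>i\<in>I. f i (\<omega> i)) = PiM I (\<lambda>i. distr (M i) (M' i) (f i))"
proof -
  interpret prob_space "PiM I M" using assms by (intro prob_space_PiM)
  have ind: "indep_vars M' (\<lambda>i \<omega>. f i (\<omega> i)) I"
    using indep_vars_compose2[OF indep_vars_PiM_coordinates[OF I M] f] by simp
  have "distr (PiM I M) (PiM I M') (\<lambda>\<omega>. \<lambda>i\<in>I. f i (\<omega> i))
      = PiM I (\<lambda>i. distr (PiM I M) (M' i) (\<lambda>\<omega>. f i (\<omega> i)))"
    using ind f I(1) by (subst (asm) indep_vars_iff_distr_eq_PiM') auto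
  also have "\<dots> = PiM I (\<lambda>i. distr (M i) (M' i) (f i))"
  proof (intro PiM_cong refl)
    fix i assume i: "i \<in> I"
    have "distr (PiM I M) (M' i) (\<lambda>\<omega>. f i (\<omega> i))
        = distr (distr (PiM I M) (M i) (\<lambda>\<omega>. \<omega> i)) (M' i) (f i)"
      using i f by (subst distr_distr) (auto simp: comp_def)
    also have "\<dots> = distr (M i) (M' i) (f i)"
      using distr_PiM_component[of I M i, OF M i] by simp
    finally show "distr (PiM I M) (M' i) (\<lambda>\<omega>. f i (\<omega> i)) = distr (M i) (M' i) (f i)" .
  qed
  finally show ?thesis .
qed

text \<open>A product of sigma-finite measures is determined by its values on boxes; on a box the
  integrand splits into functions of one coordinate each, so the integral factors.\<close>

lemma PiM_density:
  fixes f :: "'i \<Rightarrow> 'a \<Rightarrow> ennreal"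
  assumes fin: "finite I" and M: "\<And>i. sigma_finite_measure (M i)"
    and D: "\<And>i. sigma_finite_measure (density (M i) (f i))"
    and f[measurable]: "\<And>i. f i \<in> borel_measurable (M i)"
  shows "PiM I (\<lambda>i. density (M i) (f i)) = density (PiM I M) (\<lambda>x. \<Prod>i\<in>I. f i (x i))"
proof -
  interpret D: product_sigma_finite "\<lambda>i. density (M i) (f i)"
    using D by (simp add: product_sigma_finite_def)
  interpret M: product_sigma_finite M
    using M by (simp add: product_sigma_finite_def)
  have prod_meas[measurable]: "(\<lambda>x. \<Prod>i\<in>I. f i (x i)) \<in> borel_measurable (PiM I M)"
    by (intro borel_measurable_prod_ennreal measurable_PiM_component_rev f)
  show ?thesis
  proof (rule D.PiM_eqI[symmetric])
    show "sets (density (PiM I M) (\<lambda>x. \<Prod>i\<in>I. f i (x i))) = sets (PiM I (\<lambda>i. density (M i) (f i)))"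
      by (simp cong: sets_PiM_cong)
    fix A assume A: "\<And>i. i \<in> I \<Longrightarrow> A i \<in> sets (density (M i) (f i))"
    then have [measurable]: "Pi\<^sub>E I A \<in> sets (PiM I M)" using fin by (intro sets_PiM_I_finite) auto
    have "emeasure (density (PiM I M) (\<lambda>x. \<Prod>i\<in>I. f i (x i))) (Pi\<^sub>E I A)
        = (\<integral>\<^sup>+x. (\<Prod>i\<in>I. f i (x i)) * indicator (Pi\<^sub>E I A) x \<partial>PiM I M)"
      by (simp add: emeasure_density)
    also have "\<dots> = (\<integral>\<^sup>+x. (\<Prod>i\<in>I. f i (x i) * indicator (A i) (x i)) \<partial>PiM I M)"
    proof (intro nn_integral_cong)
      fix x assume x: "x \<in> space (PiM I M)"
      have "(indicator (Pi\<^sub>E I A) x :: ennreal) = (\<Prod>i\<in>I. indicator (A i) (x i))"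
      proof (cases "x \<in> Pi\<^sub>E I A")
        case False
        \<comment> \<open>A point of the space is extensional, so it can leave the box only through
          a coordinate in \<open>I\<close>.\<close>
        then obtain i where "i \<in> I" "x i \<notin> A i" using x by (auto simp: space_PiM PiE_def)
        then have "(\<Prod>i\<in>I. indicator (A i) (x i)) = (0::ennreal)"
          using fin by (intro prod_zero bexI[of _ i]) auto
        then show ?thesis using False by simp
      qed (auto simp: PiE_def Pi_def)
      then show "(\<Prod>i\<in>I. f i (x i)) * indicator (Pi\<^sub>E I A) x
          = (\<Prod>i\<in>I. f i (x i) * indicator (A i) (x i))"
        by (simp add: prod.distrib)
    qed
    also have "\<dots> = (\<Prod>i\<in>I. \<integral>\<^sup>+x. f i x * indicator (A i) x \<partial>M i)"
      using A fin by (intro M.product_nn_integral_prod) auto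
    also have "\<dots> = (\<Prod>i\<in>I. emeasure (density (M i) (f i)) (A i))"
      using A by (intro prod.cong) (auto simp: emeasure_density)
    finally show "emeasure (density (PiM I M) (\<lambda>x. \<Prod>i\<in>I. f i (x i))) (Pi\<^sub>E I A)
        = (\<Prod>i\<in>I. emeasure (density (M i) (f i)) (A i))" .
  qed fact
qed

lemma distr_normal_shift:
  "distr (density lborel (normal_density 0 \<sigma>)) lborel (\<lambda>x. a + x) = density lborel (normal_density a \<sigma>)"
proof -
  have "density lborel (normal_density a \<sigma>) = density (distr lborel borel ((+) a)) (normal_density a \<sigma>)"
    by (simp add: lborel_distr_plus)
  also have "\<dots> = distr (density lborel (\<lambda>x. normal_density a \<sigma> (a + x))) borel ((+) a)"
    by (subst density_distr) auto
  also have "(\<lambda>x. normal_density a \<sigma> (a + x)) = normal_density 0 \<sigma>"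
    by (simp add: normal_density_def fun_eq_iff)
  finally show ?thesis by (simp cong: distr_cong)
qed

text \<open>This makes \<open>likelihood\<close> a density with respect to one measure free of
  \<psi>, the condition under which \<open>fisher_information\<close> has its intended
  meaning.\<close>

lemma observation_law_eq_density:
  assumes "1 \<le> N" "0 < \<sigma>"
  shows "observation_law N \<theta>0 \<sigma> \<psi>
    = density (\<Pi>\<^sub>M j\<in>{..<N}. lborel) (\<lambda>x. ennreal (likelihood N \<theta>0 \<sigma> \<psi> x))"
proof -
  have ps: "prob_space (density lborel (\<lambda>x. ennreal (normal_density m \<sigma> x)))" for m
    using prob_space_normal_density[OF assms(2)] .
  have "observation_law N \<theta>0 \<sigma> \<psi>
      = PiM {..<N} (\<lambda>j. distr (density lborel (normal_density 0 \<sigma>)) lborel (\<lambda>x. \<theta>0 j + \<psi> + x))"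
    unfolding observation_law_def noise_law_def observation_def
    using assms ps by (intro distr_PiM_coordinatewise) (auto simp: lessThan_empty_iff)
  also have "\<dots> = PiM {..<N} (\<lambda>j. density lborel (normal_density (\<theta>0 j + \<psi>) \<sigma>))"
    by (simp only: distr_normal_shift)
  also have "\<dots> = density (\<Pi>\<^sub>M j\<in>{..<N}. lborel)
      (\<lambda>x. \<Prod>j<N. ennreal (normal_density (\<theta>0 j + \<psi>) \<sigma> (x j)))"
    by (intro PiM_density sigma_finite_lborel prob_space_imp_sigma_finite[OF ps]) auto
  finally show ?thesis by (simp add: likelihood_def prod_ennreal)
qed

subsection \<open>Fisher information and the Cramer-Rao bound\<close>

lemma prob_space_noise_law:
  assumes "0 < \<sigma>"
  shows "prob_space (noise_law N \<sigma>)"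
  unfolding noise_law_def using prob_space_normal_density[OF assms] by (intro prob_space_PiM)

lemma measurable_noise_coordinate[measurable]:
  "j < N \<Longrightarrow> (\<lambda>\<epsilon>. \<epsilon> j) \<in> borel_measurable (noise_law N \<sigma>)"
  unfolding noise_law_def by measurable

lemma measurable_lborel_coordinate:
  "j < N \<Longrightarrow> (\<lambda>\<epsilon>. \<epsilon> j) \<in> borel_measurable (\<Pi>\<^sub>M j\<in>{..<N}. lborel)"
  by measurable

lemma measurable_observation[measurable]:
  "observation N \<theta>0 \<Psi> \<in> measurable (noise_law N \<sigma>) (\<Pi>\<^sub>M j\<in>{..<N}. lborel)"
  unfolding observation_def by measurable

lemma sets_observation_law[simp]:
  "sets (observation_law N \<theta>0 \<sigma> \<Psi>) = sets (\<Pi>\<^sub>M j\<in>{..<N}. lborel)"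
  by (simp add: observation_law_def)

lemma prob_space_observation_law:
  assumes "0 < \<sigma>"
  shows "prob_space (observation_law N \<theta>0 \<sigma> \<Psi>)"
  unfolding observation_law_def
  by (rule prob_space.prob_space_distr[OF prob_space_noise_law[OF assms] measurable_observation])

lemma indep_vars_noise_law:
  assumes "1 \<le> N" "0 < \<sigma>" "\<And>j. j < N \<Longrightarrow> f j \<in> borel_measurable borel"
  shows "prob_space.indep_vars (noise_law N \<sigma>) (\<lambda>_. borel) (\<lambda>j \<epsilon>. f j (\<epsilon> j)) {..<N}"
proof -
  interpret prob_space "noise_law N \<sigma>" by (rule prob_space_noise_law) fact
  have "indep_vars (\<lambda>_. density lborel (\<lambda>x. ennreal (normal_density 0 \<sigma> x))) (\<lambda>j \<epsilon>. \<epsilon> j) {..<N}"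
    unfolding noise_law_def using assms(1,2) prob_space_normal_density[OF assms(2)]
    by (intro indep_vars_PiM_coordinates) (auto simp: lessThan_empty_iff)
  then show ?thesis
    by (rule indep_vars_compose2) (use assms(3) in auto)
qed

text \<open>The marginal of the product measure at \<open>j\<close> is the Gaussian itself, so
  questions about one coordinate become integrals over the line.\<close>

lemma noise_law_coordinate:
  fixes f :: "real \<Rightarrow> real"
  assumes "0 < \<sigma>" "j < N" and [measurable]: "f \<in> borel_measurable borel"
  shows integrable_noise_coordinate_iff:
      "integrable (noise_law N \<sigma>) (\<lambda>\<epsilon>. f (\<epsilon> j)) \<longleftrightarrow> integrable lborel (\<lambda>x. normal_density 0 \<sigma> x * f x)"
    and integral_noise_coordinate:
      "(\<integral>\<epsilon>. f (\<epsilon> j) \<partial>noise_law N \<sigma>) = (\<integral>x. normal_density 0 \<sigma> x * f x \<partial>lborel)"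
proof -
  let ?G = "density lborel (\<lambda>x. ennreal (normal_density 0 \<sigma> x))"
  have G: "distr (noise_law N \<sigma>) ?G (\<lambda>\<epsilon>. \<epsilon> j) = ?G"
    unfolding noise_law_def using prob_space_normal_density[OF assms(1)] assms(2)
    by (intro distr_PiM_component) auto
  have m: "(\<lambda>\<epsilon>. \<epsilon> j) \<in> measurable (noise_law N \<sigma>) ?G"
    using measurable_noise_coordinate[OF assms(2)] by simp
  show "integrable (noise_law N \<sigma>) (\<lambda>\<epsilon>. f (\<epsilon> j))
      \<longleftrightarrow> integrable lborel (\<lambda>x. normal_density 0 \<sigma> x * f x)"
    using integrable_distr_eq[OF m, of f] by (simp add: G integrable_real_density)
  show "(\<integral>\<epsilon>. f (\<epsilon> j) \<partial>noise_law N \<sigma>) = (\<integral>x. normal_density 0 \<sigma> x * f x \<partial>lborel)"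
    using integral_distr[OF m, of f] by (simp add: G integral_real_density)
qed

lemma noise_moments:
  assumes "0 < \<sigma>" "j < N"
  shows integrable_noise_power: "integrable (noise_law N \<sigma>) (\<lambda>\<epsilon>. \<epsilon> j ^ k)"
    and noise_mean: "(\<integral>\<epsilon>. \<epsilon> j \<partial>noise_law N \<sigma>) = 0"
    and noise_second_moment: "(\<integral>\<epsilon>. (\<epsilon> j)\<^sup>2 \<partial>noise_law N \<sigma>) = \<sigma>\<^sup>2"
    and noise_fourth_moment: "(\<integral>\<epsilon>. \<epsilon> j ^ 4 \<partial>noise_law N \<sigma>) = 3 * \<sigma> ^ 4"
proof -
  show "integrable (noise_law N \<sigma>) (\<lambda>\<epsilon>. \<epsilon> j ^ k)"
    using integrable_normal_moment[OF assms(1), of 0 k]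
    by (subst integrable_noise_coordinate_iff[OF assms, of "\<lambda>x. x ^ k"]) auto
  show "(\<integral>\<epsilon>. \<epsilon> j \<partial>noise_law N \<sigma>) = 0"
    using integral_normal_moment_nz_1[OF assms(1), of 0]
    by (subst integral_noise_coordinate[OF assms, of "\<lambda>x. x"]) auto
  show "(\<integral>\<epsilon>. (\<epsilon> j)\<^sup>2 \<partial>noise_law N \<sigma>) = \<sigma>\<^sup>2"
    using integral_normal_moment_even[OF assms(1), of 0 1]
    by (subst integral_noise_coordinate[OF assms, of "\<lambda>x. x\<^sup>2"]) simp_all
  \<comment> \<open>The even-moment formula gives \<open>4! / (2^2 * 2!) = 3\<close> as the
    coefficient of \<open>\<sigma>^4\<close>.\<close>
  have "fact 4 = (24::real)" by (simp add: fact_numeral)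
  then show "(\<integral>\<epsilon>. \<epsilon> j ^ 4 \<partial>noise_law N \<sigma>) = 3 * \<sigma> ^ 4"
    using integral_normal_moment_even[OF assms(1), of 0 2]
    by (subst integral_noise_coordinate[OF assms, of "\<lambda>x. x ^ 4"])
      (auto simp: power2_eq_square power4_eq_xxxx)
qed

section \<open>Likelihood, score and Fisher information\<close>

lemma likelihood_pos: "0 < \<sigma> \<Longrightarrow> 0 < likelihood N \<theta>0 \<sigma> \<psi> x"
  by (auto simp: likelihood_def intro!: prod_pos normal_density_pos)

lemma measurable_likelihood[measurable]:
  "likelihood N \<theta>0 \<sigma> \<psi> \<in> borel_measurable (\<Pi>\<^sub>M j\<in>{..<N}. lborel)"
  unfolding likelihood_def by (intro borel_measurable_prod measurable_compose[OF measurable_lborel_coordinate]) auto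

text \<open>The log-likelihood is a sum of quadratics in the parameter, so the score is affine in
  the data. Under the law with parameter \<psi> it is the noise sum divided by
  \<open>\<sigma>^2\<close>.\<close>

lemma deriv_ln_likelihood:
  assumes "0 < \<sigma>"
  shows "deriv (\<lambda>t. ln (likelihood N \<theta>0 \<sigma> t x)) \<psi> = (\<Sum>j<N. x j - \<theta>0 j - \<psi>) / \<sigma>\<^sup>2"
proof (rule DERIV_imp_deriv)
  have "ln (likelihood N \<theta>0 \<sigma> t x)
      = (\<Sum>j<N. ln (1 / sqrt (2 * pi * \<sigma>\<^sup>2)) - (x j - (\<theta>0 j + t))\<^sup>2 / (2 * \<sigma>\<^sup>2))" for t
  proof -
    have "ln (likelihood N \<theta>0 \<sigma> t x) = (\<Sum>j<N. ln (normal_density (\<theta>0 j + t) \<sigma> (x j)))"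
      unfolding likelihood_def using normal_density_pos[OF assms] by (subst ln_prod) (auto simp: less_imp_neq[symmetric])
    also have "\<dots> = (\<Sum>j<N. ln (1 / sqrt (2 * pi * \<sigma>\<^sup>2)) - (x j - (\<theta>0 j + t))\<^sup>2 / (2 * \<sigma>\<^sup>2))"
    proof (intro sum.cong refl)
      fix j
      have "0 < 1 / sqrt (2 * pi * \<sigma>\<^sup>2)" using assms by simp
      then show "ln (normal_density (\<theta>0 j + t) \<sigma> (x j))
          = ln (1 / sqrt (2 * pi * \<sigma>\<^sup>2)) - (x j - (\<theta>0 j + t))\<^sup>2 / (2 * \<sigma>\<^sup>2)"
        unfolding normal_density_def by (subst ln_mult) auto
    qed
    finally show ?thesis .
  qed
  moreover have "((\<lambda>t. \<Sum>j<N. ln (1 / sqrt (2 * pi * \<sigma>\<^sup>2)) - (x j - (\<theta>0 j + t))\<^sup>2 / (2 * \<sigma>\<^sup>2))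
      has_real_derivative (\<Sum>j<N. (x j - \<theta>0 j - \<psi>) / \<sigma>\<^sup>2)) (at \<psi>)"
    using assms by (intro DERIV_sum) (auto intro!: derivative_eq_intros simp: field_simps)
  ultimately show "((\<lambda>t. ln (likelihood N \<theta>0 \<sigma> t x)) has_real_derivative
      (\<Sum>j<N. x j - \<theta>0 j - \<psi>) / \<sigma>\<^sup>2) (at \<psi>)"
    by (simp add: sum_divide_distrib)
qed

text \<open>Pulled back to the noise, the score is a sum of \<open>N\<close> independent centred
  variables over \<open>\<sigma>^2\<close>, and variances add.\<close>

lemma fisher_information_observation_law:
  assumes "1 \<le> N" "0 < \<sigma>"
  shows "fisher_information (observation_law N \<theta>0 \<sigma>) (likelihood N \<theta>0 \<sigma>) \<psi> = real N / \<sigma>\<^sup>2"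
proof -
  interpret prob_space "noise_law N \<sigma>" by (rule prob_space_noise_law) fact
  have "fisher_information (observation_law N \<theta>0 \<sigma>) (likelihood N \<theta>0 \<sigma>) \<psi>
      = (\<integral>x. ((\<Sum>j<N. x j - \<theta>0 j - \<psi>) / \<sigma>\<^sup>2)\<^sup>2 \<partial>observation_law N \<theta>0 \<sigma> \<psi>)"
    unfolding fisher_information_def deriv_ln_likelihood[OF assms(2)] ..
  also have "\<dots> = expectation (\<lambda>\<epsilon>. ((\<Sum>j<N. observation N \<theta>0 \<psi> \<epsilon> j - \<theta>0 j - \<psi>) / \<sigma>\<^sup>2)\<^sup>2)"
    unfolding observation_law_def
    by (intro integral_distr measurable_observation borel_measurable_power borel_measurable_divide
        borel_measurable_sum borel_measurable_diff measurable_lborel_coordinate) auto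
  also have "\<dots> = expectation (\<lambda>\<epsilon>. (\<Sum>j<N. \<epsilon> j)\<^sup>2 / \<sigma> ^ 4)"
    by (simp add: observation_def power_divide)
  also have "\<dots> = expectation (\<lambda>\<epsilon>. (\<Sum>j<N. \<epsilon> j)\<^sup>2) / \<sigma> ^ 4" by simp
  also have "expectation (\<lambda>\<epsilon>. (\<Sum>j<N. \<epsilon> j)\<^sup>2) = (\<Sum>j<N. expectation (\<lambda>\<epsilon>. (\<epsilon> j)\<^sup>2))"
    using indep_vars_noise_law[OF assms, of "\<lambda>_ x. x"] assms(2)
    by (intro indep_sum_second_moment) (auto simp: integrable_noise_power noise_mean)
  also have "\<dots> = real N * \<sigma>\<^sup>2"
    using assms by (simp add: noise_second_moment)
  finally show ?thesis using assms by (simp add: power2_eq_square power4_eq_xxxx)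
qed

text \<open>\<open>L\<close> stands for a likelihood ratio: its mean is one, and weighting by it
  moves the mean of \<open>T\<close> by \<open>h\<close>. So \<open>T\<close> and \<open>L\<close>
  have covariance \<open>h\<close>, \<open>L\<close> has variance \<open>k\<close>, and the bound is
  Cauchy-Schwarz, read off from the nonnegative second moment of
  \<open>(T - \<mu>) - c (L - 1)\<close>.\<close>

lemma (in prob_space) chapman_robbins:
  fixes T L :: "'a \<Rightarrow> real"
  assumes [measurable]: "random_variable borel T" "random_variable borel L"
    and iT: "integrable M (\<lambda>x. (T x)\<^sup>2)" and iL: "integrable M (\<lambda>x. (L x)\<^sup>2)"
    and L1: "expectation L = 1" and LT: "expectation (\<lambda>x. L x * T x) = expectation T + h"
    and L2: "expectation (\<lambda>x. (L x)\<^sup>2) = 1 + k" and k: "0 < k"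
  shows "h\<^sup>2 / k \<le> variance T"
proof -
  define \<mu> where "\<mu> = expectation T"
  have iT1: "integrable M T" and iL1: "integrable M L"
    using iT iL by (auto intro: square_integrable_imp_integrable)
  have iLT: "integrable M (\<lambda>x. L x * T x)"
  proof (rule Bochner_Integration.integrable_bound[where f="\<lambda>x. (L x)\<^sup>2 + (T x)\<^sup>2"])
    have "\<bar>a * b\<bar> \<le> \<bar>a\<^sup>2 + b\<^sup>2\<bar>" for a b :: real
      using sum_squares_bound[of a b] sum_squares_bound[of a "-b"] by (simp add: abs_if)
    then show "AE x in M. norm (L x * T x) \<le> norm ((L x)\<^sup>2 + (T x)\<^sup>2)" by simp
  qed (use iT iL in auto)
  \<comment> \<open>The maximiser of the resulting lower bound \<open>2 c h - c^2 k\<close>.\<close>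
  define c where "c = h / k"
  have eq: "((T x - \<mu>) - c * (L x - 1))\<^sup>2 = (T x - \<mu>)\<^sup>2 - 2 * c * (L x * T x - T x - \<mu> * L x + \<mu>)
      + c\<^sup>2 * ((L x)\<^sup>2 - 2 * L x + 1)" for x
    by (simp add: power2_eq_square algebra_simps)
  have "(T x - \<mu>)\<^sup>2 = (T x)\<^sup>2 - 2 * \<mu> * T x + \<mu>\<^sup>2" for x
    by (simp add: power2_eq_square algebra_simps)
  then have iV: "integrable M (\<lambda>x. (T x - \<mu>)\<^sup>2)" using iT iT1 by simp
  have "0 \<le> expectation (\<lambda>x. ((T x - \<mu>) - c * (L x - 1))\<^sup>2)"
    by (intro Bochner_Integration.integral_nonneg) simp
  also have "\<dots> = expectation (\<lambda>x. (T x - \<mu>)\<^sup>2) - 2 * c * h + c\<^sup>2 * k"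
    unfolding eq using iT1 iL1 iLT iL iV LT L1 L2 by (simp add: prob_space \<mu>_def)
  finally have "2 * c * h - c\<^sup>2 * k \<le> variance T" by (simp add: \<mu>_def)
  moreover have "2 * c * h - c\<^sup>2 * k = h\<^sup>2 / k"
    using k by (simp add: c_def power2_eq_square field_simps)
  ultimately show ?thesis by simp
qed

text \<open>The parameter \<open>\<psi> + h\<close> is the midpoint of \<psi> and
  \<open>\<psi> + 2 h\<close>. Completing the square,
  \<open>2 (d - h)^2 = (d - 2 h)^2 + d^2 - 2 h^2\<close>, produces the factor
  \<open>exp (h^2 / \<sigma>^2)\<close> in each coordinate.\<close>

lemma likelihood_square:
  assumes "0 < \<sigma>"
  shows "(likelihood N \<theta>0 \<sigma> (\<psi> + h) x)\<^sup>2
    = exp (real N * h\<^sup>2 / \<sigma>\<^sup>2) * (likelihood N \<theta>0 \<sigma> (\<psi> + 2 * h) x * likelihood N \<theta>0 \<sigma> \<psi> x)"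
proof -
  have "(normal_density (a + h) \<sigma> y)\<^sup>2
      = exp (h\<^sup>2 / \<sigma>\<^sup>2) * (normal_density (a + 2 * h) \<sigma> y * normal_density a \<sigma> y)" for a y
  proof -
    have "- (y - (a + h))\<^sup>2 / (2 * \<sigma>\<^sup>2) + - (y - (a + h))\<^sup>2 / (2 * \<sigma>\<^sup>2)
       = h\<^sup>2 / \<sigma>\<^sup>2 + (- (y - (a + 2 * h))\<^sup>2 / (2 * \<sigma>\<^sup>2) + - (y - a)\<^sup>2 / (2 * \<sigma>\<^sup>2))"
      using assms by (simp add: divide_simps) (simp add: power2_eq_square algebra_simps)
    then have "exp (- (y - (a + h))\<^sup>2 / (2 * \<sigma>\<^sup>2)) * exp (- (y - (a + h))\<^sup>2 / (2 * \<sigma>\<^sup>2))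
       = exp (h\<^sup>2 / \<sigma>\<^sup>2) * (exp (- (y - (a + 2 * h))\<^sup>2 / (2 * \<sigma>\<^sup>2)) * exp (- (y - a)\<^sup>2 / (2 * \<sigma>\<^sup>2)))"
      by (simp only: exp_add[symmetric])
    then show ?thesis
      unfolding normal_density_def power2_eq_square[of "_ * exp _"] by (simp only: mult_ac)
  qed
  from this[of "\<theta>0 j + \<psi>" "x j" for j]
  have "(likelihood N \<theta>0 \<sigma> (\<psi> + h) x)\<^sup>2 = (\<Prod>j<N. exp (h\<^sup>2 / \<sigma>\<^sup>2) *
      (normal_density (\<theta>0 j + (\<psi> + 2 * h)) \<sigma> (x j) * normal_density (\<theta>0 j + \<psi>) \<sigma> (x j)))"
    unfolding likelihood_def by (simp add: prod_power_distrib add.assoc)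
  also have "\<dots> = exp (h\<^sup>2 / \<sigma>\<^sup>2) ^ N * (likelihood N \<theta>0 \<sigma> (\<psi> + 2 * h) x * likelihood N \<theta>0 \<sigma> \<psi> x)"
    by (simp add: prod.distrib likelihood_def)
  finally show ?thesis by (simp add: exp_of_nat_mult[symmetric])
qed

lemma observation_law_shift_density:
  assumes "1 \<le> N" "0 < \<sigma>"
  shows "observation_law N \<theta>0 \<sigma> (\<psi> + h) = density (observation_law N \<theta>0 \<sigma> \<psi>)
    (\<lambda>x. ennreal (likelihood N \<theta>0 \<sigma> (\<psi> + h) x / likelihood N \<theta>0 \<sigma> \<psi> x))"
proof -
  have "ennreal (likelihood N \<theta>0 \<sigma> \<psi> x) * ennreal (likelihood N \<theta>0 \<sigma> (\<psi> + h) x / likelihood N \<theta>0 \<sigma> \<psi> x)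
      = ennreal (likelihood N \<theta>0 \<sigma> (\<psi> + h) x)" for x
    using likelihood_pos[OF assms(2), of N \<theta>0 _ x]
    by (simp add: ennreal_mult[symmetric] less_imp_le less_imp_neq[symmetric])
  then show ?thesis
    unfolding observation_law_eq_density[OF assms] by (subst density_density_eq) auto
qed

text \<open>The squared ratio for \<open>h\<close> is a constant times the ratio for
  \<open>2 h\<close>, which integrates to one, so the variance of the ratio is exactly the
  denominator in the bound. The mean of \<open>T\<close> enters only at \<psi> and
  \<open>\<psi> + h\<close>.\<close>

lemma chapman_robbins_observation_law:
  assumes N: "1 \<le> N" "0 < \<sigma>" and h: "h \<noteq> 0"
    and T: "integrable (observation_law N \<theta>0 \<sigma> \<psi>) (\<lambda>x. (T x)\<^sup>2)"
    and T0: "integrable (observation_law N \<theta>0 \<sigma> \<psi>) T" "(\<integral>x. T x \<partial>observation_law N \<theta>0 \<sigma> \<psi>) = \<psi>"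
    and Th: "(\<integral>x. T x \<partial>observation_law N \<theta>0 \<sigma> (\<psi> + h)) = \<psi> + h"
  shows "h\<^sup>2 / (exp (real N * h\<^sup>2 / \<sigma>\<^sup>2) - 1) \<le> prob_space.variance (observation_law N \<theta>0 \<sigma> \<psi>) T"
proof -
  let ?P = "observation_law N \<theta>0 \<sigma>"
  interpret prob_space "?P \<psi>" by (rule prob_space_observation_law) fact
  define L where "L = (\<lambda>h x. likelihood N \<theta>0 \<sigma> (\<psi> + h) x / likelihood N \<theta>0 \<sigma> \<psi> x)"
  have [measurable]: "random_variable borel (L h)" for h
    unfolding L_def by (simp cong: measurable_cong_sets)
  have [measurable]: "random_variable borel T" using T0 by auto
  have Lpos: "0 \<le> L h x" for h x
    using likelihood_pos[OF N(2), of N \<theta>0 _ x] by (simp add: L_def less_imp_le)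
  have P: "?P (\<psi> + h) = density (?P \<psi>) (\<lambda>x. ennreal (L h x))" for h
    unfolding L_def by (rule observation_law_shift_density[OF N])
  have one: "(\<integral>x. 1 \<partial>?P (\<psi> + h)) = (1::real)" for h
    using prob_space.prob_space[OF prob_space_observation_law[OF N(2)]] by simp
  have L1: "expectation (L h) = 1" for h
    using one[of h] Lpos unfolding P by (subst (asm) integral_real_density) auto
  \<comment> \<open>A non-integrable function has integral 0 by convention, which contradicts the
    value 1.\<close>
  have iL: "integrable (?P \<psi>) (L h)" for h
    using L1[of h] not_integrable_integral_eq by force
  have LT: "expectation (\<lambda>x. L h x * T x) = \<psi> + h"
    using Th Lpos unfolding P by (subst (asm) integral_real_density) auto
  have sq: "(L h x)\<^sup>2 = exp (real N * h\<^sup>2 / \<sigma>\<^sup>2) * L (2 * h) x" for x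
    using likelihood_pos[OF N(2), of N \<theta>0 \<psi> x] likelihood_square[OF N(2), of N \<theta>0 \<psi> h x]
    by (simp add: L_def power_divide field_simps power2_eq_square)
  show ?thesis
  proof (rule chapman_robbins[where L="L h"])
    show "integrable (?P \<psi>) (\<lambda>x. (L h x)\<^sup>2)" unfolding sq using iL by simp
    show "expectation (\<lambda>x. (L h x)\<^sup>2) = 1 + (exp (real N * h\<^sup>2 / \<sigma>\<^sup>2) - 1)"
      unfolding sq using L1 by simp
    show "0 < exp (real N * h\<^sup>2 / \<sigma>\<^sup>2) - 1" using N h by simp
  qed (use T T0 LT L1 in auto)
qed

text \<open>The Chapman-Robbins bound holds for every small \<open>h > 0\<close>; its lower bound
  tends to \<open>1 / c\<close> as \<open>h\<close> tends to 0, where \<open>c\<close> is the Fisher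
  information.\<close>

lemma cramer_rao_observation_law:
  assumes N: "1 \<le> N" "0 < \<sigma>"
    and ub: "unbiased_near (observation_law N \<theta>0 \<sigma>) T \<psi>"
    and T: "integrable (observation_law N \<theta>0 \<sigma> \<psi>) (\<lambda>x. (T x)\<^sup>2)"
  shows "\<sigma>\<^sup>2 / real N \<le> prob_space.variance (observation_law N \<theta>0 \<sigma> \<psi>) T"
proof -
  define c where "c = real N / \<sigma>\<^sup>2"
  have c: "0 < c" using N by (simp add: c_def)
  let ?V = "prob_space.variance (observation_law N \<theta>0 \<sigma> \<psi>) T"
  obtain r where r: "0 < r" "\<And>t. dist t \<psi> < r \<Longrightarrow>
      integrable (observation_law N \<theta>0 \<sigma> t) T \<and> (\<integral>x. T x \<partial>observation_law N \<theta>0 \<sigma> t) = t"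
    using ub unfolding unbiased_near_def eventually_nhds_metric by blast
  \<comment> \<open>The inequality \<open>exp y - 1 \<le> y + y^2\<close> on the unit interval gives
    an explicit expression with the right limit, while \<open>h < r\<close> keeps
    \<open>\<psi> + h\<close> inside the neighbourhood of unbiasedness.\<close>
  have bound: "1 / (c + c\<^sup>2 * h\<^sup>2) \<le> ?V" if h: "0 < h" "h < r" "c * h\<^sup>2 \<le> 1" for h
  proof -
    have "h\<^sup>2 / (exp (real N * h\<^sup>2 / \<sigma>\<^sup>2) - 1) \<le> ?V"
      using h r by (intro chapman_robbins_observation_law[OF N _ T]) (auto simp: dist_real_def)
    also have "real N * h\<^sup>2 / \<sigma>\<^sup>2 = c * h\<^sup>2" by (simp add: c_def)
    finally have "h\<^sup>2 / (exp (c * h\<^sup>2) - 1) \<le> ?V" .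
    moreover have "1 / (c + c\<^sup>2 * h\<^sup>2) = h\<^sup>2 / (c * h\<^sup>2 + (c * h\<^sup>2)\<^sup>2)"
    proof -
      have "c * h\<^sup>2 + (c * h\<^sup>2)\<^sup>2 = h\<^sup>2 * (c + c\<^sup>2 * h\<^sup>2)" by (simp add: power2_eq_square algebra_simps)
      then show ?thesis using h by simp
    qed
    moreover have "exp (c * h\<^sup>2) - 1 \<le> c * h\<^sup>2 + (c * h\<^sup>2)\<^sup>2"
      using exp_bound[of "c * h\<^sup>2"] c h by simp
    moreover have "0 < exp (c * h\<^sup>2) - 1" using c h by simp
    ultimately show ?thesis
      by (smt (verit) divide_left_mono zero_le_power2 mult_pos_pos)
  qed
  have "((\<lambda>h. 1 / (c + c\<^sup>2 * h\<^sup>2)) \<longlongrightarrow> 1 / (c + c\<^sup>2 * 0\<^sup>2)) (at_right 0)"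
    using c by (intro tendsto_intros) auto
  moreover have "\<forall>\<^sub>F h in at_right 0. 1 / (c + c\<^sup>2 * h\<^sup>2) \<le> ?V"
  proof -
    have "((\<lambda>h. c * h\<^sup>2) \<longlongrightarrow> c * 0\<^sup>2) (at_right 0)" by (intro tendsto_intros)
    then have "\<forall>\<^sub>F h in at_right 0. c * h\<^sup>2 < 1" by (rule order_tendstoD) simp
    moreover have "\<forall>\<^sub>F h in at_right 0. h \<in> {0<..<r}" using r(1) by (rule eventually_at_right_real)
    ultimately show ?thesis
      by eventually_elim (auto intro!: bound)
  qed
  ultimately have "1 / (c + c\<^sup>2 * 0\<^sup>2) \<le> ?V"
    by (rule tendsto_upperbound) simp
  then show ?thesis by (simp add: c_def)
qed

subsection \<open>Deterministic and probabilistic error bounds\<close>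

text \<open>\<open>Arg\<close> is continuous off the closed negative real axis, equals \<pi> on the
  axis without 0, and is 0 at 0; two indicators glue these pieces.\<close>

lemma borel_measurable_Arg[measurable]: "Arg \<in> borel_measurable borel"
proof -
  have eq: "Arg = (\<lambda>z. indicator (- \<real>\<^sub>\<le>\<^sub>0) z *\<^sub>R Arg z + pi * indicator (\<real>\<^sub>\<le>\<^sub>0 - {0}) z)"
  proof
    fix z
    show "Arg z = indicator (- \<real>\<^sub>\<le>\<^sub>0) z *\<^sub>R Arg z + pi * indicator (\<real>\<^sub>\<le>\<^sub>0 - {0}) z"
    proof (cases "z = 0")
      case True
      then show ?thesis by (simp add: Arg_zero)
    next
      case False
      then show ?thesis
        by (auto simp: indicator_def complex_nonpos_Reals_iff Arg_eq_pi complex_eq_iff)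
    qed
  qed
  have m1: "(\<lambda>z. indicator (- \<real>\<^sub>\<le>\<^sub>0) z *\<^sub>R Arg z) \<in> borel_measurable borel"
    by (intro borel_measurable_continuous_on_indicator continuous_on_Arg) auto
  have m2: "(\<lambda>z. pi * indicator (\<real>\<^sub>\<le>\<^sub>0 - {0::complex}) z) \<in> borel_measurable borel"
    by (intro borel_measurable_times borel_measurable_indicator borel_measurable_const) auto
  show ?thesis by (subst eq) (rule borel_measurable_add[OF m1 m2])
qed

text \<open>By the mean value theorem \<open>t - arctan t = t z^2 / (1 + z^2)\<close> with
  \<open>0 < z < t\<close>, and \<open>z / (1 + z^2) \<le> 1\<close>. A quadratic bound suffices,
  since squaring it gives a fourth power.\<close>

lemma abs_arctan_diff_le: "\<bar>arctan t - t\<bar> \<le> t\<^sup>2"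
proof -
  have pos: "\<bar>arctan t - t\<bar> \<le> t\<^sup>2" if t: "0 < t" for t
  proof -
    obtain z where z: "0 < z" "z < t" "arctan t - arctan 0 = (t - 0) * inverse (1 + z\<^sup>2)"
      using MVT2[OF t, of arctan "\<lambda>x. inverse (1 + x\<^sup>2)"] DERIV_arctan by auto
    have p: "0 < 1 + z\<^sup>2" by (simp add: add_pos_nonneg)
    define q where "q = z * (z / (1 + z\<^sup>2))"
    have "t - arctan t = t * q"
      using z(3) p by (simp add: q_def field_simps power2_eq_square)
    moreover have "0 \<le> q" using z p by (simp add: q_def)
    moreover have "q \<le> t * 1"
      unfolding q_def
    proof (rule mult_mono)
      have "z \<le> 1 + z\<^sup>2" using sum_squares_bound[of z 1] z by simp
      then show "z / (1 + z\<^sup>2) \<le> 1" using p by simp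
    qed (use z p t in auto)
    ultimately have "0 \<le> t - arctan t" "t - arctan t \<le> t * t"
      using t by (simp_all add: mult_left_mono)
    then show ?thesis by (simp add: power2_eq_square)
  qed
  show ?thesis
  proof (cases t "0::real" rule: linorder_cases)
    case less
    then show ?thesis using pos[of "-t"] by (simp add: arctan_minus abs_minus_commute)
  qed (use pos in auto)
qed

text \<open>Off the event \<open>\<bar>a - 1\<bar> \<le> 1/2\<close> only the bound by \<open>\<pi>\<close> is available;
  there \<open>(a - m) ^ 4\<close> is bounded below, so no separate tail estimate is needed.\<close>

lemma phase_minus_sine_bound:
  fixes a b m w :: real
  assumes m: "3 / 4 \<le> m" "m \<le> 1" and w: "\<bar>w\<bar> \<le> pi"
    and arg: "0 < a \<Longrightarrow> w = arctan (b / a)"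
  shows "(w - b)\<^sup>2 \<le> 8448 * (b ^ 4 + (a - m) ^ 4 + (1 - m)\<^sup>2 * b\<^sup>2)"
proof (cases "\<bar>a - 1\<bar> \<le> 1 / 2")
  case True
  then have a: "1 / 2 \<le> a" by linarith
  have "\<bar>b / a\<bar> \<le> 2 * \<bar>b\<bar>"
    using a mult_right_mono[of 1 "2 * a" "\<bar>b\<bar>"] by (simp add: abs_divide divide_le_eq mult_ac)
  then have "(b / a)\<^sup>2 \<le> (2 * b)\<^sup>2" by (subst abs_le_square_iff[symmetric]) (simp add: abs_mult)
  then have 1: "\<bar>arctan (b / a) - b / a\<bar> \<le> 4 * b\<^sup>2"
    using abs_arctan_diff_le[of "b / a"] by (simp add: power_mult_distrib)
  \<comment> \<open>Besides the error of the arctangent, \<open>w - b\<close> contains the effect of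
    replacing the denominator \<open>a\<close> by 1; \<open>1 - a\<close> is then split into a
    fluctuation \<open>m - a\<close> and a bias \<open>1 - m\<close>.\<close>
  have "b / a - b = (b / a) * (1 - a)" using a by (simp add: field_simps)
  then have "\<bar>b / a - b\<bar> \<le> (2 * \<bar>b\<bar>) * \<bar>1 - a\<bar>"
    using mult_right_mono[OF \<open>\<bar>b / a\<bar> \<le> 2 * \<bar>b\<bar>\<close>, of "\<bar>1 - a\<bar>"] by (simp only: abs_mult)
  also have "\<dots> \<le> (2 * \<bar>b\<bar>) * (\<bar>a - m\<bar> + (1 - m))"
    using m by (intro mult_left_mono) auto
  finally have "\<bar>b / a - b\<bar> \<le> 2 * \<bar>b\<bar> * (\<bar>a - m\<bar> + (1 - m))" .
  have wb: "\<bar>w - b\<bar> \<le> 4 * b\<^sup>2 + 2 * (\<bar>b\<bar> * \<bar>a - m\<bar>) + 2 * ((1 - m) * \<bar>b\<bar>)"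
  proof -
    have "2 * \<bar>b\<bar> * (\<bar>a - m\<bar> + (1 - m)) = 2 * (\<bar>b\<bar> * \<bar>a - m\<bar>) + 2 * ((1 - m) * \<bar>b\<bar>)"
      by (simp add: algebra_simps)
    moreover have "w = arctan (b / a)" using arg a by simp
    ultimately show ?thesis
      using 1 \<open>\<bar>b / a - b\<bar> \<le> 2 * \<bar>b\<bar> * (\<bar>a - m\<bar> + (1 - m))\<close> by linarith
  qed
  have "(w - b)\<^sup>2 \<le> (4 * b\<^sup>2 + 2 * (\<bar>b\<bar> * \<bar>a - m\<bar>) + 2 * ((1 - m) * \<bar>b\<bar>))\<^sup>2"
    using power_mono[OF wb abs_ge_zero, of 2] by simp
  also have "\<dots> \<le> 3 * ((4 * b\<^sup>2)\<^sup>2 + (2 * (\<bar>b\<bar> * \<bar>a - m\<bar>))\<^sup>2 + (2 * ((1 - m) * \<bar>b\<bar>))\<^sup>2)"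
  proof -
    have "(x + y + z)\<^sup>2 \<le> 3 * (x\<^sup>2 + y\<^sup>2 + z\<^sup>2)" for x y z :: real
      using sum_squares_bound[of x y] sum_squares_bound[of y z] sum_squares_bound[of x z]
      by (simp add: power2_eq_square algebra_simps)
    then show ?thesis .
  qed
  also have "\<dots> = 48 * b ^ 4 + 12 * (b\<^sup>2 * (a - m)\<^sup>2) + 12 * ((1 - m)\<^sup>2 * b\<^sup>2)"
    by (simp add: power_mult_distrib flip: power_mult)
  also have "b\<^sup>2 * (a - m)\<^sup>2 \<le> b ^ 4 + (a - m) ^ 4"
  proof -
    have "2 * (b\<^sup>2 * (a - m)\<^sup>2) \<le> b ^ 4 + (a - m) ^ 4"
      using sum_squares_bound[of "b\<^sup>2" "(a - m)\<^sup>2"] by (simp add: mult_ac)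
    moreover have "0 \<le> b\<^sup>2 * (a - m)\<^sup>2" by simp
    ultimately show ?thesis by linarith
  qed
  finally have "(w - b)\<^sup>2 \<le> 60 * b ^ 4 + 12 * (a - m) ^ 4 + 12 * ((1 - m)\<^sup>2 * b\<^sup>2)" by simp
  moreover have "0 \<le> b ^ 4" "0 \<le> (a - m) ^ 4" "0 \<le> (1 - m)\<^sup>2 * b\<^sup>2" by auto
  \<comment> \<open>Stated for arbitrary reals so that the fourth powers and the product become
    atoms of linear arithmetic.\<close>
  moreover have "y \<le> 60 * p + 12 * q + 12 * r \<Longrightarrow> 0 \<le> p \<Longrightarrow> 0 \<le> q \<Longrightarrow> 0 \<le> r \<Longrightarrow> y \<le> 8448 * (p + q + r)"
    for y p q r :: real by simp
  ultimately show ?thesis by blast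
next
  case False
  \<comment> \<open>From \<open>\<bar>a - 1\<bar> > 1/2\<close> and
    \<open>1 - m \<le> 1/4\<close>.\<close>
  then have "1 / 4 \<le> \<bar>a - m\<bar>" using m by linarith
  then have "(1 / 4) ^ 4 \<le> \<bar>a - m\<bar> ^ 4" by (intro power_mono) auto
  then have c: "1 \<le> 256 * (a - m) ^ 4" by (simp add: power_divide)
  have "w\<^sup>2 \<le> 4\<^sup>2" using w pi_less_4 by (intro power2_le_iff_abs_le[THEN iffD2]) auto
  moreover have "(w - b)\<^sup>2 \<le> 2 * w\<^sup>2 + 2 * b\<^sup>2"
    using sum_squares_bound[of w "-b"] by (simp add: power2_eq_square algebra_simps)
  moreover have "2 * b\<^sup>2 \<le> 1 + b ^ 4"
    using sum_squares_bound[of "b\<^sup>2" 1] by simp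
  \<comment> \<open>The constant is \<open>33 = 2 * 4^2 + 1\<close>. It is absorbed by
    \<open>256 (a - m)^4 \<ge> 1\<close>, whence \<open>8448 = 33 * 256\<close>.\<close>
  ultimately have "(w - b)\<^sup>2 \<le> 33 + b ^ 4" by simp
  moreover have "0 \<le> b ^ 4" "0 \<le> (1 - m)\<^sup>2 * b\<^sup>2" by auto
  moreover have "y \<le> 33 + p \<Longrightarrow> 0 \<le> p \<Longrightarrow> 0 \<le> r \<Longrightarrow> 1 \<le> 256 * q \<Longrightarrow> y \<le> 8448 * (p + q + r)"
    for y p q r :: real by simp
  ultimately show ?thesis using c by blast
qed

text \<open>The first bound is Young's inequality on the cross term \<open>2 (w - l) l\<close>, with
  \<delta> free so that the part proportional to the main term can be made small. For the second,
  \<open>L\<close> is centred, so the mean of \<open>W\<close> is that of \<open>W - L\<close>, and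
  its square is at most the second moment.\<close>

lemma (in prob_space) second_moment_perturbation:
  fixes W L :: "'a \<Rightarrow> real"
  assumes [measurable]: "random_variable borel W" "random_variable borel L"
    and iW: "integrable M (\<lambda>x. (W x)\<^sup>2)" and iL: "integrable M (\<lambda>x. (L x)\<^sup>2)"
    and L0: "expectation L = 0"
    and D: "expectation (\<lambda>x. (W x - L x)\<^sup>2) \<le> D"
    and \<delta>: "0 < \<delta>"
  shows "\<bar>expectation (\<lambda>x. (W x)\<^sup>2) - expectation (\<lambda>x. (L x)\<^sup>2)\<bar>
      \<le> (1 + 1 / \<delta>) * D + \<delta> * expectation (\<lambda>x. (L x)\<^sup>2)" (is ?A)
    and "(expectation W)\<^sup>2 \<le> D" (is ?B)
proof -
  have i1: "integrable M W" "integrable M L"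
    using iW iL by (auto intro: square_integrable_imp_integrable)
  have iD: "integrable M (\<lambda>x. (W x - L x)\<^sup>2)"
  proof (rule Bochner_Integration.integrable_bound[where f="\<lambda>x. 2 * (W x)\<^sup>2 + 2 * (L x)\<^sup>2"])
    have "(a - b)\<^sup>2 \<le> \<bar>2 * a\<^sup>2 + 2 * b\<^sup>2\<bar>" for a b :: real
      using sum_squares_bound[of a "-b"] by (simp add: power2_eq_square algebra_simps)
    then show "AE x in M. norm ((W x - L x)\<^sup>2) \<le> norm (2 * (W x)\<^sup>2 + 2 * (L x)\<^sup>2)" by simp
  qed (use iW iL in auto)
  have pt: "\<bar>w\<^sup>2 - l\<^sup>2\<bar> \<le> (1 + 1 / \<delta>) * (w - l)\<^sup>2 + \<delta> * l\<^sup>2" for w l :: real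
  proof -
    have "2 * \<bar>w - l\<bar> * \<bar>l\<bar> \<le> (w - l)\<^sup>2 / \<delta> + \<delta> * l\<^sup>2"
      using sum_squares_bound[of "\<bar>w - l\<bar> / sqrt \<delta>" "sqrt \<delta> * \<bar>l\<bar>"] \<delta>
      by (simp add: power_divide power_mult_distrib mult_ac)
    moreover have "\<bar>w\<^sup>2 - l\<^sup>2\<bar> \<le> (w - l)\<^sup>2 + 2 * \<bar>w - l\<bar> * \<bar>l\<bar>"
    proof -
      have "w\<^sup>2 - l\<^sup>2 = (w - l)\<^sup>2 + 2 * ((w - l) * l)" by (simp add: power2_eq_square algebra_simps)
      then have "\<bar>w\<^sup>2 - l\<^sup>2\<bar> \<le> \<bar>(w - l)\<^sup>2\<bar> + \<bar>2 * ((w - l) * l)\<bar>" using abs_triangle_ineq by metis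
      then show ?thesis by (simp only: abs_mult abs_numeral abs_power2 mult.assoc)
    qed
    ultimately show ?thesis by (simp add: algebra_simps)
  qed
  have "\<bar>expectation (\<lambda>x. (W x)\<^sup>2) - expectation (\<lambda>x. (L x)\<^sup>2)\<bar>
      = \<bar>expectation (\<lambda>x. (W x)\<^sup>2 - (L x)\<^sup>2)\<bar>" using iW iL by simp
  also have "\<dots> \<le> expectation (\<lambda>x. \<bar>(W x)\<^sup>2 - (L x)\<^sup>2\<bar>)" by (rule integral_abs_bound)
  also have "\<dots> \<le> expectation (\<lambda>x. (1 + 1 / \<delta>) * (W x - L x)\<^sup>2 + \<delta> * (L x)\<^sup>2)"
    using iW iL iD pt by (intro integral_mono) auto
  also have "\<dots> = (1 + 1 / \<delta>) * expectation (\<lambda>x. (W x - L x)\<^sup>2) + \<delta> * expectation (\<lambda>x. (L x)\<^sup>2)"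
    using iL iD by simp
  also have "\<dots> \<le> (1 + 1 / \<delta>) * D + \<delta> * expectation (\<lambda>x. (L x)\<^sup>2)"
    using D \<delta> by (intro add_right_mono mult_left_mono) auto
  finally show ?A .
  have "(expectation W)\<^sup>2 = (expectation (\<lambda>x. W x - L x))\<^sup>2" using i1 L0 by simp
  also have "\<dots> \<le> expectation (\<lambda>x. (W x - L x)\<^sup>2)"
  proof -
    have "variance (\<lambda>x. W x - L x) = expectation (\<lambda>x. (W x - L x)\<^sup>2) - (expectation (\<lambda>x. W x - L x))\<^sup>2"
      using i1 iD by (intro variance_eq) auto
    with variance_positive[of "\<lambda>x. W x - L x"] show ?thesis by linarith
  qed
  finally show ?B using D by simp
qed

text \<open>Up to a positive factor, \<open>cis (Arg z - \<alpha>)\<close> is \<open>z\<close>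
  rotated by \<open>-\<alpha>\<close>; in the right half plane the principal argument is an
  arctangent, so no wrapping occurs.\<close>

lemma wrapped_error_eq_arctan:
  assumes "0 < Re (z * cis (- \<alpha>))"
  shows "wrapped_error (Arg z) \<alpha> = arctan (Im (z * cis (- \<alpha>)) / Re (z * cis (- \<alpha>)))"
proof -
  have z: "z \<noteq> 0" using assms by auto
  have "cis (Arg z - \<alpha>) = sgn z * cis (- \<alpha>)"
    using z by (simp add: diff_conv_add_uminus cis_mult[symmetric] cis_Arg del: cis_mult add_uminus_conv_diff)
  also have "\<dots> = (z * cis (- \<alpha>)) / of_real (cmod z)" by (simp add: sgn_eq)
  finally have "cis (Arg z - \<alpha>) = (z * cis (- \<alpha>)) / of_real (cmod z)" .
  then show ?thesis
    unfolding wrapped_error_def using assms z by (simp add: arg_conv_arctan)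
qed

lemma abs_wrapped_error_le_pi: "\<bar>wrapped_error a b\<bar> \<le> pi"
  unfolding wrapped_error_def using Arg_bounded[of "cis (a - b)"] by linarith

lemma order_parameter_polar:
  "order_parameter N (\<lambda>j. \<theta> j + \<epsilon> j) * cis (- Arg (order_parameter N \<theta>))
    = (\<Sum>j<N. cis (\<theta> j - Arg (order_parameter N \<theta>) + \<epsilon> j)) / of_nat N"
  by (simp add: order_parameter_def sum_distrib_right cis_mult algebra_simps)

text \<open>Rotating \<open>Z\<close> by minus its argument gives the nonnegative real
  \<open>cmod Z\<close>; the two sums are the real and imaginary parts of this identity.\<close>

lemma sum_cis_centred:
  assumes "1 \<le> N" "0 < R_of N \<theta>"
  shows sum_cos_centred: "(\<Sum>j<N. cos (\<theta> j - Arg (order_parameter N \<theta>))) = real N * R_of N \<theta>"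
    and sum_sin_centred: "(\<Sum>j<N. sin (\<theta> j - Arg (order_parameter N \<theta>))) = 0"
proof -
  let ?Z = "order_parameter N \<theta>"
  have "(\<Sum>j<N. cis (\<theta> j - Arg ?Z)) / of_nat N = ?Z * cis (- Arg ?Z)"
    using order_parameter_polar[of N \<theta> "\<lambda>_. 0"] by simp
  also have "\<dots> = of_real (R_of N \<theta>)"
  proof -
    have "rcis (cmod ?Z) (Arg ?Z) * rcis 1 (- Arg ?Z) = of_real (cmod ?Z)"
      by (simp only: rcis_mult) simp
    then show ?thesis by (simp only: rcis_cmod_Arg R_of_def cis_rcis_eq)
  qed
  finally have eq: "(\<Sum>j<N. cis (\<theta> j - Arg ?Z)) = of_real (real N * R_of N \<theta>)"
    using assms(1) by (simp add: field_simps)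
  show "(\<Sum>j<N. cos (\<theta> j - Arg ?Z)) = real N * R_of N \<theta>"
    using arg_cong[OF eq, of Re] by simp
  show "(\<Sum>j<N. sin (\<theta> j - Arg ?Z)) = 0"
    using arg_cong[OF eq, of Im] by simp
qed

text \<open>The lower bound is Cauchy-Schwarz against the constant vector, using that the centred
  cosines sum to \<open>N R\<close>. It is exactly the statement that the efficiency is at most
  one.\<close>

lemma q2_bounds:
  assumes "1 \<le> N" "0 < R_of N \<theta>"
  shows q2_le_one: "q2_of N \<theta> \<le> 1"
    and R_square_le_q2: "(R_of N \<theta>)\<^sup>2 \<le> q2_of N \<theta>"
    and q2_pos: "0 < q2_of N \<theta>"
proof -
  define c where "c = (\<lambda>j. cos (\<theta> j - Arg (order_parameter N \<theta>)))"
  have "(\<Sum>j<N. (c j)\<^sup>2) \<le> (\<Sum>j<N. 1)"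
    by (intro sum_mono) (simp add: c_def abs_square_le_1)
  then show "q2_of N \<theta> \<le> 1"
    using assms by (simp add: q2_of_def c_def divide_le_eq)
  have "(real N * R_of N \<theta>)\<^sup>2 \<le> real N * (\<Sum>j<N. (c j)\<^sup>2)"
    using Cauchy_Schwarz_ineq_sum[of "\<lambda>_. 1" c "{..<N}"] sum_cos_centred[OF assms] by (simp add: c_def)
  then have "real N * (real N * (R_of N \<theta>)\<^sup>2) \<le> real N * (\<Sum>j<N. (c j)\<^sup>2)"
    by (simp add: power2_eq_square mult_ac)
  then have "real N * (R_of N \<theta>)\<^sup>2 \<le> (\<Sum>j<N. (c j)\<^sup>2)"
    using assms by (simp only: mult_le_cancel_left_pos of_nat_0_less_iff)
  then show "(R_of N \<theta>)\<^sup>2 \<le> q2_of N \<theta>"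
    using assms by (simp add: q2_of_def c_def le_divide_eq mult.commute)
  with assms(2) show "0 < q2_of N \<theta>" by (meson less_le_trans zero_less_power)
qed

section \<open>Moments of trigonometric functions of the noise\<close>

definition mean_cos :: "real \<Rightarrow> real" where
  "mean_cos \<sigma> = (\<integral>x. normal_density 0 \<sigma> x * cos x \<partial>lborel)"

lemma integrable_noise_bounded:
  fixes f :: "real \<Rightarrow> real"
  assumes "0 < \<sigma>" "j < N" and [measurable]: "f \<in> borel_measurable borel"
    and "\<And>x. \<bar>f x\<bar> \<le> B * (1 + x ^ 4)"
  shows "integrable (noise_law N \<sigma>) (\<lambda>\<epsilon>. f (\<epsilon> j))"
proof (rule Bochner_Integration.integrable_bound[where f="\<lambda>\<epsilon>. B * (1 + \<epsilon> j ^ 4)"])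
  interpret prob_space "noise_law N \<sigma>" by (rule prob_space_noise_law) fact
  show "integrable (noise_law N \<sigma>) (\<lambda>\<epsilon>. B * (1 + \<epsilon> j ^ 4))"
    using integrable_noise_power[OF assms(1,2), of 4] by simp
  show "AE \<epsilon> in noise_law N \<sigma>. norm (f (\<epsilon> j)) \<le> norm (B * (1 + \<epsilon> j ^ 4))"
    using order_trans[OF assms(4) abs_ge_self] by simp
  show "(\<lambda>\<epsilon>. f (\<epsilon> j)) \<in> borel_measurable (noise_law N \<sigma>)"
    using measurable_compose[OF measurable_noise_coordinate[OF assms(2)] assms(3)] .
qed

text \<open>In the addition formula the term with the sine of the noise has mean zero by the
  symmetry of the Gaussian. The cosine case is obtained by shifting \<open>u\<close> by
  \<open>pi / 2\<close>.\<close>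

lemma noise_mean_sin:
  assumes "0 < \<sigma>" "j < N"
  shows "(\<integral>\<epsilon>. sin (u + \<epsilon> j) \<partial>noise_law N \<sigma>) = mean_cos \<sigma> * sin u"
proof -
  have [measurable]: "(\<lambda>x. sin x :: real) \<in> borel_measurable borel" "(\<lambda>x. cos x :: real) \<in> borel_measurable borel"
    by measurable
  have b: "1 \<le> 1 * (1 + x ^ 4)" for x :: real by simp
  have isin: "integrable (noise_law N \<sigma>) (\<lambda>\<epsilon>. sin (\<epsilon> j))"
    by (rule integrable_noise_bounded[OF assms, where B=1]) (auto intro: order_trans[OF abs_sin_le_one b[unfolded mult_1]])
  have icos: "integrable (noise_law N \<sigma>) (\<lambda>\<epsilon>. cos (\<epsilon> j))"
    by (rule integrable_noise_bounded[OF assms, where B=1]) (auto intro: order_trans[OF abs_cos_le_one b[unfolded mult_1]])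
  have "(\<integral>x. normal_density 0 \<sigma> x * sin x \<partial>lborel)
      = \<bar>-1\<bar> *\<^sub>R (\<integral>x. normal_density 0 \<sigma> (0 + (-1) * x) * sin (0 + (-1) * x) \<partial>lborel)"
    by (rule lborel_integral_real_affine) simp
  also have "\<dots> = - (\<integral>x. normal_density 0 \<sigma> x * sin x \<partial>lborel)"
    by (simp add: normal_density_def)
  finally have "(\<integral>\<epsilon>. sin (\<epsilon> j) \<partial>noise_law N \<sigma>) = 0"
    by (subst integral_noise_coordinate[OF assms, of sin]) auto
  moreover have "(\<integral>\<epsilon>. cos (\<epsilon> j) \<partial>noise_law N \<sigma>) = mean_cos \<sigma>"
    unfolding mean_cos_def by (rule integral_noise_coordinate[OF assms]) simp
  ultimately show ?thesis
    using isin icos by (simp add: sin_add mult.commute)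
qed

lemma cos_ge_quadratic: "1 - x\<^sup>2 / 2 \<le> cos (x::real)"
proof -
  have "(sin (x / 2))\<^sup>2 \<le> (x / 2)\<^sup>2"
    by (rule abs_le_square_iff[THEN iffD1, OF abs_sin_x_le_abs_x])
  then show ?thesis
    using cos_double_sin[of "x / 2"] by (simp add: power_divide)
qed

text \<open>\<open>mean_cos\<close> is the characteristic function of the noise at 1. It does not
  depend on \<open>N\<close>, so the pointwise bounds on the cosine are integrated over a single
  noise coordinate.\<close>

lemma mean_cos_bounds:
  assumes "0 < \<sigma>"
  shows mean_cos_le_one: "mean_cos \<sigma> \<le> 1" and one_minus_mean_cos_le: "1 - mean_cos \<sigma> \<le> \<sigma>\<^sup>2 / 2"
proof -
  interpret prob_space "noise_law (Suc 0) \<sigma>" by (rule prob_space_noise_law) fact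
  have eq: "mean_cos \<sigma> = expectation (\<lambda>\<epsilon>. cos (\<epsilon> 0))"
    unfolding mean_cos_def by (rule integral_noise_coordinate[symmetric, OF assms]) auto
  have icos: "integrable (noise_law (Suc 0) \<sigma>) (\<lambda>\<epsilon>. cos (\<epsilon> 0))"
    by (rule integrable_noise_bounded[OF assms, where B=1])
      (auto intro: order_trans[OF abs_cos_le_one])
  have i2: "integrable (noise_law (Suc 0) \<sigma>) (\<lambda>\<epsilon>. (\<epsilon> 0)\<^sup>2)"
    by (rule integrable_noise_power[OF assms]) simp
  have "expectation (\<lambda>\<epsilon>. cos (\<epsilon> 0)) \<le> expectation (\<lambda>\<epsilon>. 1)"
    using icos by (intro integral_mono) auto
  then show "mean_cos \<sigma> \<le> 1" by (simp add: eq prob_space)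
  have "expectation (\<lambda>\<epsilon>. 1 - (\<epsilon> 0)\<^sup>2 / 2) \<le> expectation (\<lambda>\<epsilon>. cos (\<epsilon> 0))"
  proof (intro integral_mono)
    fix \<epsilon> :: "nat \<Rightarrow> real"
    show "1 - (\<epsilon> 0)\<^sup>2 / 2 \<le> cos (\<epsilon> 0)" by (rule cos_ge_quadratic)
  qed (use icos i2 in auto)
  then show "1 - mean_cos \<sigma> \<le> \<sigma>\<^sup>2 / 2"
    using i2 noise_second_moment[OF assms, of 0 "Suc 0"] by (simp add: eq prob_space)
qed

lemma power4_add_le: "(a + b) ^ 4 \<le> 8 * (a ^ 4 + b ^ 4)" for a b :: real
proof -
  have sq: "(x + y)\<^sup>2 \<le> 2 * (x\<^sup>2 + y\<^sup>2)" for x y :: real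
    using sum_squares_bound[of x y] by (simp add: power2_eq_square algebra_simps)
  have "((a + b)\<^sup>2)\<^sup>2 \<le> (2 * (a\<^sup>2 + b\<^sup>2))\<^sup>2"
    by (intro power_mono sq) simp
  also have "\<dots> = 4 * (a\<^sup>2 + b\<^sup>2)\<^sup>2" by (simp only: power_mult_distrib) simp
  also have "\<dots> \<le> 4 * (2 * ((a\<^sup>2)\<^sup>2 + (b\<^sup>2)\<^sup>2))" by (intro mult_left_mono sq) simp
  finally show ?thesis by (simp flip: power_mult)
qed

text \<open>The form of \<open>indep_sum_moments\<close> used for every normalised sum below:
  functions of separate noise coordinates, one common variance bound \<open>v\<close>, and a common
  denominator \<open>c\<close>.\<close>

lemma noise_sum_moments:
  fixes f :: "nat \<Rightarrow> real \<Rightarrow> real"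
  assumes N: "1 \<le> N" "0 < \<sigma>"
    and f: "\<And>j. f j \<in> borel_measurable borel"
    and i4: "\<And>j. j < N \<Longrightarrow> integrable (noise_law N \<sigma>) (\<lambda>\<epsilon>. f j (\<epsilon> j) ^ 4)"
    and e1: "\<And>j. j < N \<Longrightarrow> (\<integral>\<epsilon>. f j (\<epsilon> j) \<partial>noise_law N \<sigma>) = 0"
    and e2: "\<And>j. j < N \<Longrightarrow> (\<integral>\<epsilon>. (f j (\<epsilon> j))\<^sup>2 \<partial>noise_law N \<sigma>) \<le> v"
  shows noise_sum_measurable: "(\<lambda>\<epsilon>. (\<Sum>j<N. f j (\<epsilon> j)) / c) \<in> borel_measurable (noise_law N \<sigma>)"
    and noise_sum_integrable_power: "k \<le> 4 \<Longrightarrow> integrable (noise_law N \<sigma>) (\<lambda>\<epsilon>. ((\<Sum>j<N. f j (\<epsilon> j)) / c) ^ k)"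
    and noise_sum_second_moment_le:
      "(\<integral>\<epsilon>. ((\<Sum>j<N. f j (\<epsilon> j)) / c)\<^sup>2 \<partial>noise_law N \<sigma>) \<le> real N * v / c\<^sup>2"
    and noise_sum_fourth_moment_le:
      "(\<And>j. j < N \<Longrightarrow> (\<integral>\<epsilon>. f j (\<epsilon> j) ^ 4 \<partial>noise_law N \<sigma>) \<le> 3 * v\<^sup>2) \<Longrightarrow>
       (\<integral>\<epsilon>. ((\<Sum>j<N. f j (\<epsilon> j)) / c) ^ 4 \<partial>noise_law N \<sigma>) \<le> 3 * (real N * v)\<^sup>2 / c ^ 4"
proof -
  interpret prob_space "noise_law N \<sigma>" by (rule prob_space_noise_law) fact
  have ind: "indep_vars (\<lambda>_. borel) (\<lambda>j \<epsilon>. f j (\<epsilon> j)) {..<N}"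
    using N f by (rule indep_vars_noise_law)
  note sum = indep_sum_moments[OF finite_lessThan ind i4 e1, simplified]
  show m: "(\<lambda>\<epsilon>. (\<Sum>j<N. f j (\<epsilon> j)) / c) \<in> borel_measurable (noise_law N \<sigma>)"
    by (intro borel_measurable_divide borel_measurable_sum borel_measurable_const
        measurable_compose[OF measurable_noise_coordinate f]) auto
  show "integrable (noise_law N \<sigma>) (\<lambda>\<epsilon>. ((\<Sum>j<N. f j (\<epsilon> j)) / c) ^ k)" if "k \<le> 4"
  proof (rule integrable_power_le_4[OF m _ that])
    show "integrable (noise_law N \<sigma>) (\<lambda>\<epsilon>. ((\<Sum>j<N. f j (\<epsilon> j)) / c) ^ 4)"
      using sum(1) by (simp add: power_divide)
  qed
  have "(\<Sum>j<N. expectation (\<lambda>\<epsilon>. (f j (\<epsilon> j))\<^sup>2)) \<le> real N * v"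
    using sum_bounded_above[of "{..<N}" "\<lambda>j. expectation (\<lambda>\<epsilon>. (f j (\<epsilon> j))\<^sup>2)" v] e2 by simp
  then show "(\<integral>\<epsilon>. ((\<Sum>j<N. f j (\<epsilon> j)) / c)\<^sup>2 \<partial>noise_law N \<sigma>) \<le> real N * v / c\<^sup>2"
    using sum(3) by (simp add: power_divide divide_right_mono)
  show "(\<integral>\<epsilon>. ((\<Sum>j<N. f j (\<epsilon> j)) / c) ^ 4 \<partial>noise_law N \<sigma>) \<le> 3 * (real N * v)\<^sup>2 / c ^ 4"
    if "\<And>j. j < N \<Longrightarrow> (\<integral>\<epsilon>. f j (\<epsilon> j) ^ 4 \<partial>noise_law N \<sigma>) \<le> 3 * v\<^sup>2"
    using sum(4)[OF e2 that] by (simp add: power_divide divide_right_mono)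
qed

text \<open>One function covers both components of the rotated order parameter: the imaginary part
  with \<open>v = u j\<close>, and the real part with \<open>v = u j + pi / 2\<close>.\<close>

definition centred_sin :: "real \<Rightarrow> real \<Rightarrow> real \<Rightarrow> real" where
  "centred_sin \<sigma> v x = sin (v + x) - mean_cos \<sigma> * sin v"

lemma measurable_centred_sin[measurable]: "centred_sin \<sigma> v \<in> borel_measurable borel"
  unfolding centred_sin_def by measurable

text \<open>The constant bound serves integrability, the second gives moments of the size of the
  noise, and the third controls the linearization. Centring costs at most
  \<open>\<sigma>^2 / 2\<close>, and \<open>\<sigma> \<le> 1/2\<close> lets this be absorbed into
  \<sigma>.\<close>

lemma centred_sin_estimates:
  assumes \<sigma>: "0 < \<sigma>" "\<sigma> \<le> 1 / 2"
  shows abs_centred_sin_le_2: "\<bar>centred_sin \<sigma> v x\<bar> \<le> 2"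
    and abs_centred_sin_le: "\<bar>centred_sin \<sigma> v x\<bar> \<le> \<bar>x\<bar> + \<sigma>"
    and abs_centred_sin_linear_le: "\<bar>centred_sin \<sigma> v x - cos v * x\<bar> \<le> x\<^sup>2 + \<sigma>\<^sup>2 / 2"
proof -
  let ?m = "mean_cos \<sigma>"
  have m: "0 \<le> 1 - ?m" "1 - ?m \<le> \<sigma>\<^sup>2 / 2"
    using mean_cos_bounds[OF \<sigma>(1)] by auto
  have s2: "\<sigma>\<^sup>2 \<le> \<sigma>" using \<sigma> by (simp add: power2_eq_square mult_left_le)
  have ms: "\<bar>(1 - ?m) * sin v\<bar> \<le> \<sigma>\<^sup>2 / 2"
    using mult_mono[OF m(2) abs_sin_le_one[of v]] m by (simp add: abs_mult)
  have m': "0 \<le> ?m" using m s2 \<sigma> by linarith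
  have "\<bar>?m * sin v\<bar> \<le> 1 * 1"
    using m m' unfolding abs_mult by (intro mult_mono) auto
  then show "\<bar>centred_sin \<sigma> v x\<bar> \<le> 2"
    unfolding centred_sin_def using abs_sin_le_one[of "v + x"] by linarith
  have eq: "centred_sin \<sigma> v x = (sin (v + x) - sin v) + (1 - ?m) * sin v"
    by (simp add: centred_sin_def algebra_simps)
  have "\<bar>sin (v + x) - sin v\<bar> \<le> \<bar>x\<bar>"
  proof -
    have "sin (v + x) - sin v = 2 * (sin (x / 2) * cos (v + x / 2))"
      using sin_diff_sin[of "v + x" v] by (simp add: algebra_simps add_divide_distrib)
    moreover have "\<bar>sin (x / 2) * cos (v + x / 2)\<bar> \<le> \<bar>x / 2\<bar> * 1"
      unfolding abs_mult by (intro mult_mono abs_sin_x_le_abs_x) auto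
    ultimately show ?thesis by (simp add: abs_mult)
  qed
  then show "\<bar>centred_sin \<sigma> v x\<bar> \<le> \<bar>x\<bar> + \<sigma>"
    unfolding eq using ms s2 \<sigma> by linarith
  have eq2: "centred_sin \<sigma> v x - cos v * x = sin v * (cos x - 1) + cos v * (sin x - x) + (1 - ?m) * sin v"
    by (simp add: centred_sin_def sin_add algebra_simps)
  have "\<bar>cos x - 1\<bar> \<le> x\<^sup>2 / 2" using cos_ge_quadratic[of x] cos_le_one[of x] by linarith
  then have 1: "\<bar>sin v * (cos x - 1)\<bar> \<le> 1 * (x\<^sup>2 / 2)"
    unfolding abs_mult by (intro mult_mono) auto
  \<comment> \<open>The Taylor polynomial of order 2 of the sine is \<open>x\<close>, so the
    remainder may be taken quadratic.\<close>
  have "\<bar>sin x - x\<bar> \<le> x\<^sup>2 / 2"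
    using Maclaurin_sin_bound[of x 2] by (simp add: numeral_2_eq_2 sin_coeff_def)
  then have 2: "\<bar>cos v * (sin x - x)\<bar> \<le> 1 * (x\<^sup>2 / 2)"
    unfolding abs_mult by (intro mult_mono) auto
  show "\<bar>centred_sin \<sigma> v x - cos v * x\<bar> \<le> x\<^sup>2 + \<sigma>\<^sup>2 / 2"
    unfolding eq2 using 1 2 ms by linarith
qed

text \<open>The fourth-moment estimate gives \<open>8 * (3 + 1) = 32\<close> times
  \<open>\<sigma>^4\<close>; it is relaxed to 48 to take the form \<open>3 v^2\<close> with
  \<open>v = 4 \<sigma>^2\<close> required for sums.\<close>

lemma centred_sin_moments:
  assumes \<sigma>: "0 < \<sigma>" "\<sigma> \<le> 1 / 2" and j: "j < N"
  shows integrable_centred_sin: "integrable (noise_law N \<sigma>) (\<lambda>\<epsilon>. centred_sin \<sigma> v (\<epsilon> j))"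
    and integrable_centred_sin_power4: "integrable (noise_law N \<sigma>) (\<lambda>\<epsilon>. centred_sin \<sigma> v (\<epsilon> j) ^ 4)"
    and centred_sin_mean: "(\<integral>\<epsilon>. centred_sin \<sigma> v (\<epsilon> j) \<partial>noise_law N \<sigma>) = 0"
    and centred_sin_second_moment: "(\<integral>\<epsilon>. (centred_sin \<sigma> v (\<epsilon> j))\<^sup>2 \<partial>noise_law N \<sigma>) \<le> 4 * \<sigma>\<^sup>2"
    and centred_sin_fourth_moment: "(\<integral>\<epsilon>. centred_sin \<sigma> v (\<epsilon> j) ^ 4 \<partial>noise_law N \<sigma>) \<le> 3 * (4 * \<sigma>\<^sup>2)\<^sup>2"
proof -
  interpret prob_space "noise_law N \<sigma>" by (rule prob_space_noise_law) fact
  have one: "B \<le> B * (1 + x ^ 4)" if "0 \<le> B" for x B :: real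
    using that mult_left_mono[of 1 "1 + x ^ 4" B] by simp
  show "integrable (noise_law N \<sigma>) (\<lambda>\<epsilon>. centred_sin \<sigma> v (\<epsilon> j))"
  proof (rule integrable_noise_bounded[OF \<sigma>(1) j, where B=2])
    show "\<bar>centred_sin \<sigma> v x\<bar> \<le> 2 * (1 + x ^ 4)" for x
      using order_trans[OF abs_centred_sin_le_2[OF \<sigma>] one[of 2]] by simp
  qed measurable
  show "integrable (noise_law N \<sigma>) (\<lambda>\<epsilon>. centred_sin \<sigma> v (\<epsilon> j) ^ 4)"
  proof (rule integrable_noise_bounded[OF \<sigma>(1) j, where B=16])
    show "\<bar>centred_sin \<sigma> v x ^ 4\<bar> \<le> 16 * (1 + x ^ 4)" for x
    proof -
      have "\<bar>centred_sin \<sigma> v x ^ 4\<bar> \<le> 16"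
        using power_mono[OF abs_centred_sin_le_2[OF \<sigma>, of v x], of 4] by (simp add: power_abs)
      also have "16 \<le> 16 * (1 + x ^ 4)" by (rule one) simp
      finally show ?thesis .
    qed
  qed measurable
  have isin: "integrable (noise_law N \<sigma>) (\<lambda>\<epsilon>. sin (v + \<epsilon> j))"
    by (rule integrable_noise_bounded[OF \<sigma>(1) j, where B=1])
      (auto intro!: order_trans[OF abs_sin_le_one])
  then show "(\<integral>\<epsilon>. centred_sin \<sigma> v (\<epsilon> j) \<partial>noise_law N \<sigma>) = 0"
    using noise_mean_sin[OF \<sigma>(1) j, of v] by (simp add: centred_sin_def prob_space)
  note ip = integrable_noise_power[OF \<sigma>(1) j]
  have "expectation (\<lambda>\<epsilon>. (centred_sin \<sigma> v (\<epsilon> j))\<^sup>2) \<le> expectation (\<lambda>\<epsilon>. 2 * (\<epsilon> j)\<^sup>2 + 2 * \<sigma>\<^sup>2)"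
  proof (rule integral_mono')
    fix \<epsilon> :: "nat \<Rightarrow> real"
    have "(centred_sin \<sigma> v (\<epsilon> j))\<^sup>2 \<le> (\<bar>\<epsilon> j\<bar> + \<sigma>)\<^sup>2"
      using power_mono[OF abs_centred_sin_le[OF \<sigma>, of v "\<epsilon> j"], of 2] by simp
    also have "\<dots> \<le> 2 * (\<epsilon> j)\<^sup>2 + 2 * \<sigma>\<^sup>2"
      using sum_squares_bound[of "\<bar>\<epsilon> j\<bar>" \<sigma>] by (simp add: power2_sum)
    finally show "(centred_sin \<sigma> v (\<epsilon> j))\<^sup>2 \<le> 2 * (\<epsilon> j)\<^sup>2 + 2 * \<sigma>\<^sup>2" .
  qed (use ip[of 2] in auto)
  also have "\<dots> = 4 * \<sigma>\<^sup>2"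
    using ip[of 2] noise_second_moment[OF \<sigma>(1) j] by (simp add: prob_space)
  finally show "expectation (\<lambda>\<epsilon>. (centred_sin \<sigma> v (\<epsilon> j))\<^sup>2) \<le> 4 * \<sigma>\<^sup>2" .
  have "expectation (\<lambda>\<epsilon>. centred_sin \<sigma> v (\<epsilon> j) ^ 4) \<le> expectation (\<lambda>\<epsilon>. 8 * (\<epsilon> j ^ 4 + \<sigma> ^ 4))"
  proof (rule integral_mono')
    fix \<epsilon> :: "nat \<Rightarrow> real"
    have "centred_sin \<sigma> v (\<epsilon> j) ^ 4 \<le> (\<bar>\<epsilon> j\<bar> + \<sigma>) ^ 4"
      using power_mono[OF abs_centred_sin_le[OF \<sigma>, of v "\<epsilon> j"], of 4] by (simp add: power_abs)
    also have "\<dots> \<le> 8 * (\<epsilon> j ^ 4 + \<sigma> ^ 4)"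
      using power4_add_le[of "\<bar>\<epsilon> j\<bar>" \<sigma>] by simp
    finally show "centred_sin \<sigma> v (\<epsilon> j) ^ 4 \<le> 8 * (\<epsilon> j ^ 4 + \<sigma> ^ 4)" .
  qed (use ip[of 4] in auto)
  also have "\<dots> = 32 * \<sigma> ^ 4"
    using ip[of 4] noise_fourth_moment[OF \<sigma>(1) j] by (simp add: prob_space)
  also have "\<dots> \<le> 48 * \<sigma> ^ 4" by simp
  also have "\<dots> = 3 * (4 * \<sigma>\<^sup>2)\<^sup>2" by (simp add: power_mult_distrib flip: power_mult)
  finally show "expectation (\<lambda>\<epsilon>. centred_sin \<sigma> v (\<epsilon> j) ^ 4) \<le> 3 * (4 * \<sigma>\<^sup>2)\<^sup>2" .
qed

text \<open>Both the centred sine and its linear part have mean zero, so the remainder is centred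
  too. Remainders in different coordinates then add in variance, giving a factor \<open>N\<close>
  instead of \<open>N^2\<close>.\<close>

lemma centred_sin_linear_moments:
  assumes \<sigma>: "0 < \<sigma>" "\<sigma> \<le> 1 / 2" and j: "j < N"
  shows integrable_centred_sin_linear_power4:
      "integrable (noise_law N \<sigma>) (\<lambda>\<epsilon>. (centred_sin \<sigma> v (\<epsilon> j) - cos v * \<epsilon> j) ^ 4)"
    and centred_sin_linear_mean: "(\<integral>\<epsilon>. centred_sin \<sigma> v (\<epsilon> j) - cos v * \<epsilon> j \<partial>noise_law N \<sigma>) = 0"
    and centred_sin_linear_second_moment:
      "(\<integral>\<epsilon>. (centred_sin \<sigma> v (\<epsilon> j) - cos v * \<epsilon> j)\<^sup>2 \<partial>noise_law N \<sigma>) \<le> 7 * \<sigma> ^ 4"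
proof -
  interpret prob_space "noise_law N \<sigma>" by (rule prob_space_noise_law) fact
  note ip = integrable_noise_power[OF \<sigma>(1) j]
  show "integrable (noise_law N \<sigma>) (\<lambda>\<epsilon>. (centred_sin \<sigma> v (\<epsilon> j) - cos v * \<epsilon> j) ^ 4)"
  proof (rule integrable_noise_bounded[OF \<sigma>(1) j, where B=128])
    fix x :: real
    have "\<bar>cos v * x\<bar> \<le> 1 * \<bar>x\<bar>" unfolding abs_mult by (intro mult_mono) auto
    then have "\<bar>centred_sin \<sigma> v x - cos v * x\<bar> \<le> 2 + \<bar>x\<bar>"
      using abs_centred_sin_le_2[OF \<sigma>, of v x] by linarith
    then have "(centred_sin \<sigma> v x - cos v * x) ^ 4 \<le> (2 + \<bar>x\<bar>) ^ 4"
      using power_mono[of "\<bar>centred_sin \<sigma> v x - cos v * x\<bar>" "2 + \<bar>x\<bar>" 4] by (simp add: power_abs)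
    also have "\<dots> \<le> 8 * (16 + x ^ 4)" using power4_add_le[of 2 "\<bar>x\<bar>"] by simp
    also have "\<dots> \<le> 128 * (1 + x ^ 4)" by simp
    finally show "\<bar>(centred_sin \<sigma> v x - cos v * x) ^ 4\<bar> \<le> 128 * (1 + x ^ 4)" by simp
  qed measurable
  show "expectation (\<lambda>\<epsilon>. centred_sin \<sigma> v (\<epsilon> j) - cos v * \<epsilon> j) = 0"
    using integrable_centred_sin[OF \<sigma> j] centred_sin_mean[OF \<sigma> j] ip[of 1] noise_mean[OF \<sigma>(1) j] by simp
  have "expectation (\<lambda>\<epsilon>. (centred_sin \<sigma> v (\<epsilon> j) - cos v * \<epsilon> j)\<^sup>2)
      \<le> expectation (\<lambda>\<epsilon>. 2 * \<epsilon> j ^ 4 + \<sigma> ^ 4 / 2)"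
  proof (rule integral_mono')
    fix \<epsilon> :: "nat \<Rightarrow> real"
    have "(centred_sin \<sigma> v (\<epsilon> j) - cos v * \<epsilon> j)\<^sup>2 \<le> ((\<epsilon> j)\<^sup>2 + \<sigma>\<^sup>2 / 2)\<^sup>2"
      using power_mono[OF abs_centred_sin_linear_le[OF \<sigma>, of v "\<epsilon> j"], of 2] by simp
    also have "\<dots> \<le> 2 * ((\<epsilon> j)\<^sup>2)\<^sup>2 + 2 * (\<sigma>\<^sup>2 / 2)\<^sup>2"
      using sum_squares_bound[of "(\<epsilon> j)\<^sup>2" "\<sigma>\<^sup>2 / 2"] by (simp add: power2_sum)
    also have "\<dots> = 2 * \<epsilon> j ^ 4 + \<sigma> ^ 4 / 2" by (simp add: power_divide flip: power_mult)
    finally show "(centred_sin \<sigma> v (\<epsilon> j) - cos v * \<epsilon> j)\<^sup>2 \<le> 2 * \<epsilon> j ^ 4 + \<sigma> ^ 4 / 2" .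
  qed (use ip[of 4] in auto)
  also have "\<dots> = 6 * \<sigma> ^ 4 + \<sigma> ^ 4 / 2"
    using ip[of 4] noise_fourth_moment[OF \<sigma>(1) j] by (simp add: prob_space)
  also have "\<dots> \<le> 7 * \<sigma> ^ 4" by simp
  finally show "expectation (\<lambda>\<epsilon>. (centred_sin \<sigma> v (\<epsilon> j) - cos v * \<epsilon> j)\<^sup>2) \<le> 7 * \<sigma> ^ 4" .
qed

subsection \<open>Linearization of the phase error\<close>

text \<open>A function of the noise for an arbitrary configuration, so that the ordinary phase and
  the full estimator are both instances.\<close>

definition phase_error :: "nat \<Rightarrow> (nat \<Rightarrow> real) \<Rightarrow> (nat \<Rightarrow> real) \<Rightarrow> real" where
  "phase_error N \<theta> \<epsilon> =
     wrapped_error (Arg (order_parameter N (\<lambda>j. \<theta> j + \<epsilon> j))) (Arg (order_parameter N \<theta>))"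

text \<open>The differential of the phase of the order parameter at zero noise.\<close>

definition linear_phase_error :: "nat \<Rightarrow> (nat \<Rightarrow> real) \<Rightarrow> (nat \<Rightarrow> real) \<Rightarrow> real" where
  "linear_phase_error N \<theta> \<epsilon> =
     (\<Sum>j<N. cos (\<theta> j - Arg (order_parameter N \<theta>)) * \<epsilon> j) / (real N * R_of N \<theta>)"

lemma measurable_wrapped_error_Arg:
  assumes "\<And>j. j < N \<Longrightarrow> (\<lambda>x. f x j) \<in> borel_measurable M"
  shows "(\<lambda>x. wrapped_error (Arg (order_parameter N (f x))) \<alpha>) \<in> borel_measurable M"
proof -
  have cis[measurable]: "cis \<in> borel_measurable borel"
    by (intro borel_measurable_continuous_onI continuous_on_cis continuous_on_id)
  have "(\<lambda>x. order_parameter N (f x)) \<in> borel_measurable M"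
    unfolding order_parameter_def
    by (intro borel_measurable_divide borel_measurable_sum borel_measurable_const
        measurable_compose[OF assms cis]) auto
  then show ?thesis unfolding wrapped_error_def by measurable
qed

text \<open>The deviation from \<open>L\<close> splits as phase error minus \<open>B\<close>,
  bounded pointwise by fourth powers, plus \<open>G = B - L\<close>, the linearization error of the
  sines. The numerical constant is uniform in \<open>N\<close> and in the configuration.\<close>

lemma phase_error_linearization:
  assumes N: "1 \<le> N" and R: "0 < R_of N \<theta>" and \<sigma>: "0 < \<sigma>" "\<sigma> \<le> 1 / 2"
  defines "\<tau> \<equiv> \<sigma>\<^sup>2 / (real N * (R_of N \<theta>)\<^sup>2)"
  defines "L \<equiv> linear_phase_error N \<theta>"
  shows measurable_phase_error: "phase_error N \<theta> \<in> borel_measurable (noise_law N \<sigma>)" (is ?mW)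
    and "L \<in> borel_measurable (noise_law N \<sigma>)" (is ?mL)
    and "integrable (noise_law N \<sigma>) (\<lambda>\<epsilon>. (L \<epsilon>)\<^sup>2)" (is ?iL)
    and "(\<integral>\<epsilon>. L \<epsilon> \<partial>noise_law N \<sigma>) = 0" (is ?eL)
    and "(\<integral>\<epsilon>. (L \<epsilon>)\<^sup>2 \<partial>noise_law N \<sigma>) = \<tau> * q2_of N \<theta>" (is ?eL2)
    and "(\<integral>\<epsilon>. (phase_error N \<theta> \<epsilon> - L \<epsilon>)\<^sup>2 \<partial>noise_law N \<sigma>) \<le> 2000000 * (\<tau> + \<sigma>\<^sup>2) * \<tau>" (is ?D)
proof -
  interpret prob_space "noise_law N \<sigma>" by (rule prob_space_noise_law) fact
  define \<alpha> where "\<alpha> = Arg (order_parameter N \<theta>)"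
  define u where "u = (\<lambda>j. \<theta> j - \<alpha>)"
  define r where "r = R_of N \<theta>"
  define c where "c = real N * r"
  define m where "m = mean_cos \<sigma>"
  have r: "0 < r" using R by (simp add: r_def)
  have c: "0 < c" using N r by (simp add: c_def)
  have N0: "0 < real N" using N by simp
  have \<tau>: "\<tau> = real N * \<sigma>\<^sup>2 / c\<^sup>2" "0 < \<tau>"
    using N r \<sigma> by (simp_all add: \<tau>_def c_def r_def[symmetric] power2_eq_square)
  have sums: "(\<Sum>j<N. cos (u j)) = c" "(\<Sum>j<N. sin (u j)) = 0"
    using sum_cis_centred[OF N R] by (simp_all add: u_def \<alpha>_def c_def r_def)
  have L: "L = (\<lambda>\<epsilon>. (\<Sum>j<N. cos (u j) * \<epsilon> j) / c)"
    by (simp add: L_def linear_phase_error_def fun_eq_iff c_def r_def u_def \<alpha>_def)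
  \<comment> \<open>Divided by \<open>r\<close>, the rotated noisy order parameter has imaginary
    part \<open>B\<close> and real part \<open>A + m\<close>.\<close>
  define B where "B = (\<lambda>\<epsilon>. (\<Sum>j<N. centred_sin \<sigma> (u j) (\<epsilon> j)) / c)"
  define A where "A = (\<lambda>\<epsilon>. (\<Sum>j<N. centred_sin \<sigma> (u j + pi / 2) (\<epsilon> j)) / c)"
  define G where "G = (\<lambda>\<epsilon>. (\<Sum>j<N. centred_sin \<sigma> (u j) (\<epsilon> j) - cos (u j) * \<epsilon> j) / c)"
  show mW: ?mW
    unfolding phase_error_def by (rule measurable_wrapped_error_Arg) simp
  have cosmom: "integrable (noise_law N \<sigma>) (\<lambda>\<epsilon>. (cos (u j) * \<epsilon> j) ^ 4)"
      "expectation (\<lambda>\<epsilon>. cos (u j) * \<epsilon> j) = 0"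
      "expectation (\<lambda>\<epsilon>. (cos (u j) * \<epsilon> j)\<^sup>2) = (cos (u j))\<^sup>2 * \<sigma>\<^sup>2" if "j < N" for j
    using integrable_noise_power[OF \<sigma>(1) that, of 4] noise_mean[OF \<sigma>(1) that]
      noise_second_moment[OF \<sigma>(1) that]
    by (simp_all add: power_mult_distrib)
  have cosle: "expectation (\<lambda>\<epsilon>. (cos (u j) * \<epsilon> j)\<^sup>2) \<le> \<sigma>\<^sup>2" if "j < N" for j
    using cosmom(3)[OF that] by (simp add: mult_left_le_one_le abs_square_le_1)
  have ind: "indep_vars (\<lambda>_. borel) (\<lambda>j \<epsilon>. cos (u j) * \<epsilon> j) {..<N}"
    by (rule indep_vars_noise_law[OF N \<sigma>(1), of "\<lambda>j x. cos (u j) * x"]) simp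
  show ?mL
    unfolding L by (rule noise_sum_measurable[OF N \<sigma>(1), of "\<lambda>j x. cos (u j) * x"])
      (use cosmom cosle in auto)
  show ?iL
    unfolding L by (rule noise_sum_integrable_power[OF N \<sigma>(1), of "\<lambda>j x. cos (u j) * x"])
      (use cosmom cosle in auto)
  show ?eL
    using indep_sum_expectation_zero[OF finite_lessThan ind] cosmom unfolding L by simp
  have "expectation (\<lambda>\<epsilon>. (\<Sum>j<N. cos (u j) * \<epsilon> j)\<^sup>2) = (\<Sum>j<N. (cos (u j))\<^sup>2 * \<sigma>\<^sup>2)"
    using indep_sum_second_moment[OF finite_lessThan ind] cosmom by simp
  also have "\<dots> = real N * q2_of N \<theta> * \<sigma>\<^sup>2"
    using N by (simp add: q2_of_def u_def \<alpha>_def sum_distrib_right)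
  finally show ?eL2
    unfolding L \<tau>(1) by (simp add: power_divide)
  have Bm: "integrable (noise_law N \<sigma>) (\<lambda>\<epsilon>. B \<epsilon> ^ 4)" "integrable (noise_law N \<sigma>) (\<lambda>\<epsilon>. (B \<epsilon>)\<^sup>2)"
      "expectation (\<lambda>\<epsilon>. (B \<epsilon>)\<^sup>2) \<le> real N * (4 * \<sigma>\<^sup>2) / c\<^sup>2"
      "expectation (\<lambda>\<epsilon>. B \<epsilon> ^ 4) \<le> 3 * (real N * (4 * \<sigma>\<^sup>2))\<^sup>2 / c ^ 4"
    unfolding B_def
    by (rule noise_sum_integrable_power[OF N \<sigma>(1)] noise_sum_second_moment_le[OF N \<sigma>(1)]
        noise_sum_fourth_moment_le[OF N \<sigma>(1)]; (rule measurable_centred_sin centred_sin_moments[OF \<sigma>] | assumption | simp)+)+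
  have Am: "integrable (noise_law N \<sigma>) (\<lambda>\<epsilon>. A \<epsilon> ^ 4)"
      "expectation (\<lambda>\<epsilon>. A \<epsilon> ^ 4) \<le> 3 * (real N * (4 * \<sigma>\<^sup>2))\<^sup>2 / c ^ 4"
    unfolding A_def
    by (rule noise_sum_integrable_power[OF N \<sigma>(1)]
        noise_sum_fourth_moment_le[OF N \<sigma>(1)]; (rule measurable_centred_sin centred_sin_moments[OF \<sigma>] | assumption | simp)+)+
  have Gm: "integrable (noise_law N \<sigma>) (\<lambda>\<epsilon>. (G \<epsilon>)\<^sup>2)"
      "expectation (\<lambda>\<epsilon>. (G \<epsilon>)\<^sup>2) \<le> real N * (7 * \<sigma> ^ 4) / c\<^sup>2"
    unfolding G_def
    by (rule noise_sum_integrable_power[OF N \<sigma>(1), of "\<lambda>j x. centred_sin \<sigma> (u j) x - cos (u j) * x"]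
        noise_sum_second_moment_le[OF N \<sigma>(1), of "\<lambda>j x. centred_sin \<sigma> (u j) x - cos (u j) * x"];
        (rule centred_sin_linear_moments[OF \<sigma>] | assumption | simp)+)+
  have G: "G \<epsilon> = B \<epsilon> - L \<epsilon>" for \<epsilon>
    by (simp add: G_def B_def L sum_subtractf diff_divide_distrib)
  have s2: "\<sigma>\<^sup>2 \<le> 1 / 4" using power_mono[OF \<sigma>(2), of 2] \<sigma>(1) by (simp add: power_divide)
  have m: "3 / 4 \<le> m" "m \<le> 1" "1 - m \<le> \<sigma>\<^sup>2 / 2"
    using mean_cos_bounds[OF \<sigma>(1)] s2 unfolding m_def by linarith+
  have W: "phase_error N \<theta> \<epsilon> = arctan (B \<epsilon> / (A \<epsilon> + m))" if pos: "0 < A \<epsilon> + m" for \<epsilon>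
  proof -
    let ?z = "order_parameter N (\<lambda>j. \<theta> j + \<epsilon> j)"
    have z: "?z * cis (- \<alpha>) = (\<Sum>j<N. cis (u j + \<epsilon> j)) / of_nat N"
      using order_parameter_polar[of N \<theta> \<epsilon>] by (simp add: u_def \<alpha>_def)
    \<comment> \<open>The centring terms \<open>m cos (u j)\<close> add up to \<open>m c\<close>,
      which is why the real part is centred at \<open>m\<close> after rescaling.\<close>
    have "(\<Sum>j<N. centred_sin \<sigma> (u j + pi / 2) (\<epsilon> j)) = (\<Sum>j<N. cos (u j + \<epsilon> j)) - m * c"
    proof -
      have "centred_sin \<sigma> (u j + pi / 2) x = cos (u j + x) - m * cos (u j)" for j x
        by (simp add: centred_sin_def m_def sin_add cos_add)
      then show ?thesis by (simp add: sum_subtractf sums(1) flip: sum_distrib_left)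
    qed
    then have Re: "Re (?z * cis (- \<alpha>)) = r * (A \<epsilon> + m)"
      unfolding z using c r N0 by (simp add: A_def c_def field_simps)
    \<comment> \<open>Here the centring terms cancel altogether, as the sines of the
      \<open>u j\<close> sum to zero.\<close>
    have "(\<Sum>j<N. centred_sin \<sigma> (u j) (\<epsilon> j)) = (\<Sum>j<N. sin (u j + \<epsilon> j))"
      by (simp add: centred_sin_def sum_subtractf sums(2) flip: sum_distrib_left)
    then have Im: "Im (?z * cis (- \<alpha>)) = r * B \<epsilon>"
      unfolding z using r N0 by (simp add: B_def c_def)
    have "0 < Re (?z * cis (- \<alpha>))" unfolding Re using pos r by simp
    then show ?thesis
      unfolding phase_error_def \<alpha>_def[symmetric]
      by (subst wrapped_error_eq_arctan) (auto simp only: Re Im mult_divide_mult_cancel_left[OF less_imp_neq[OF r, symmetric]])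
  qed
  define F where "F = (\<lambda>\<epsilon>. 2 * (8448 * (B \<epsilon> ^ 4 + A \<epsilon> ^ 4 + (1 - m)\<^sup>2 * (B \<epsilon>)\<^sup>2)) + 2 * (G \<epsilon>)\<^sup>2)"
  have WL: "(phase_error N \<theta> \<epsilon> - L \<epsilon>)\<^sup>2 \<le> F \<epsilon>" for \<epsilon>
  proof -
    have "(phase_error N \<theta> \<epsilon> - B \<epsilon>)\<^sup>2
        \<le> 8448 * (B \<epsilon> ^ 4 + (A \<epsilon> + m - m) ^ 4 + (1 - m)\<^sup>2 * (B \<epsilon>)\<^sup>2)"
      by (rule phase_minus_sine_bound[OF m(1,2)])
        (use abs_wrapped_error_le_pi in \<open>auto simp: phase_error_def intro: W[unfolded phase_error_def]\<close>)
    moreover have "(phase_error N \<theta> \<epsilon> - L \<epsilon>)\<^sup>2 \<le> 2 * (phase_error N \<theta> \<epsilon> - B \<epsilon>)\<^sup>2 + 2 * (G \<epsilon>)\<^sup>2"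
      using sum_squares_bound[of "phase_error N \<theta> \<epsilon> - B \<epsilon>" "G \<epsilon>"]
      by (simp add: G power2_eq_square algebra_simps)
    ultimately show ?thesis unfolding F_def by simp
  qed
  have "expectation (\<lambda>\<epsilon>. (phase_error N \<theta> \<epsilon> - L \<epsilon>)\<^sup>2) \<le> expectation F"
  proof (rule integral_mono')
    show "integrable (noise_law N \<sigma>) F" unfolding F_def using Bm Am Gm by simp
    show "0 \<le> F \<epsilon>" for \<epsilon> using WL[of \<epsilon>] zero_le_power2 order_trans by blast
  qed (rule WL)
  also have "expectation F = 16896 * (expectation (\<lambda>\<epsilon>. B \<epsilon> ^ 4) + expectation (\<lambda>\<epsilon>. A \<epsilon> ^ 4)
      + (1 - m)\<^sup>2 * expectation (\<lambda>\<epsilon>. (B \<epsilon>)\<^sup>2)) + 2 * expectation (\<lambda>\<epsilon>. (G \<epsilon>)\<^sup>2)"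
    unfolding F_def using Bm Am Gm by simp
  \<comment> \<open>The fourth moments of \<open>B\<close> and \<open>A\<close> are at most
    \<open>3 * 4^2 * \<tau>^2\<close> each, the second moment of \<open>B\<close> at most
    \<open>4 \<tau>\<close>, and that of \<open>G\<close> at most
    \<open>7 \<sigma>^2 \<tau>\<close>.\<close>
  also have "\<dots> \<le> 16896 * (48 * \<tau>\<^sup>2 + 48 * \<tau>\<^sup>2 + \<sigma>\<^sup>2 * (4 * \<tau>)) + 2 * (7 * (\<sigma>\<^sup>2 * \<tau>))"
  proof -
    have "3 * (real N * (4 * \<sigma>\<^sup>2))\<^sup>2 / c ^ 4 = 48 * \<tau>\<^sup>2"
      by (simp add: \<tau>(1) power_divide power_mult_distrib flip: power_mult)
    moreover have "(1 - m)\<^sup>2 * expectation (\<lambda>\<epsilon>. (B \<epsilon>)\<^sup>2) \<le> \<sigma>\<^sup>2 * (4 * \<tau>)"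
    proof (rule mult_mono)
      have "(1 - m) * (1 - m) \<le> 1 * (\<sigma>\<^sup>2 / 2)" using m by (intro mult_mono) auto
      then show "(1 - m)\<^sup>2 \<le> \<sigma>\<^sup>2"
        unfolding power2_eq_square[of "1 - m"] using zero_le_power2[of \<sigma>] by linarith
      show "expectation (\<lambda>\<epsilon>. (B \<epsilon>)\<^sup>2) \<le> 4 * \<tau>" using Bm(3) by (simp add: \<tau>(1) mult_ac)
    qed auto
    moreover have "real N * (7 * \<sigma> ^ 4) / c\<^sup>2 = 7 * (\<sigma>\<^sup>2 * \<tau>)"
      by (simp add: \<tau>(1) power4_eq_xxxx power2_eq_square)
    ultimately show ?thesis using Bm(4) Am(2) Gm(2) by (intro add_mono mult_left_mono) auto
  qed
  also have "\<dots> = 1622016 * \<tau>\<^sup>2 + 67598 * (\<sigma>\<^sup>2 * \<tau>)" by simp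
  also have "\<dots> \<le> 2000000 * \<tau>\<^sup>2 + 2000000 * (\<sigma>\<^sup>2 * \<tau>)"
    using \<tau>(2) by (intro add_mono mult_right_mono) auto
  also have "\<dots> = 2000000 * (\<tau> + \<sigma>\<^sup>2) * \<tau>" by (simp add: power2_eq_square algebra_simps)
  finally show ?D .
qed

text \<open>The threshold \<open>d\<close> is chosen before \<open>N\<close> and the configuration,
  which expresses the joint small-error regime. The variance is handled together with the second
  moment, as the squared mean is itself of lower order.\<close>

lemma phase_error_asymptotics:
  assumes e: "0 < e"
  shows "\<exists>d>0. \<forall>N \<theta> \<sigma>. 1 \<le> N \<longrightarrow> 0 < R_of N \<theta> \<longrightarrow> 0 < \<sigma> \<longrightarrow> \<sigma> < d \<longrightarrow>
      \<sigma> / (R_of N \<theta> * sqrt (real N)) < d \<longrightarrow>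
      \<bar>(\<integral>\<epsilon>. (phase_error N \<theta> \<epsilon>)\<^sup>2 \<partial>noise_law N \<sigma>) - arg_Z_mse_leading N \<theta> \<sigma>\<bar>
        \<le> e * (\<sigma>\<^sup>2 / (real N * (R_of N \<theta>)\<^sup>2)) \<and>
      \<bar>prob_space.variance (noise_law N \<sigma>) (phase_error N \<theta>) - arg_Z_mse_leading N \<theta> \<sigma>\<bar>
        \<le> e * (\<sigma>\<^sup>2 / (real N * (R_of N \<theta>)\<^sup>2))"
proof -
  \<comment> \<open>The perturbation bound is used with \<open>\<delta> = e / 2\<close>, and 4000000
    is twice the linearization constant because \<tau> and \<open>\<sigma>^2\<close> are both at
    most \<open>d^2\<close>. The choice of \<open>d\<close> makes \<open>K d^2 \<le> e / 4\<close>,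
    so the error budget in units of \<tau> is \<open>e/4 + e/2\<close> for the second moment and a
    further \<open>e/4\<close> for the squared mean.\<close>
  define K where "K = (1 + 1 / (e / 2)) * 4000000"
  have K: "4000000 \<le> K" using e by (simp add: K_def)
  define d where "d = min (1 / 2) (sqrt (e / (4 * K)))"
  have d: "0 < d" "d \<le> 1 / 2" using e K by (auto simp: d_def)
  have "d\<^sup>2 \<le> (sqrt (e / (4 * K)))\<^sup>2" using d(1) by (intro power_mono) (auto simp: d_def)
  then have Kd: "K * d\<^sup>2 \<le> e / 4" using e K by (simp add: field_simps)
  show ?thesis
  proof (intro exI[of _ d] conjI allI impI)
    fix N :: nat and \<theta> :: "nat \<Rightarrow> real" and \<sigma> :: real
    assume N: "1 \<le> N" and R: "0 < R_of N \<theta>" and \<sigma>: "0 < \<sigma>" "\<sigma> < d"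
      and s: "\<sigma> / (R_of N \<theta> * sqrt (real N)) < d"
    interpret prob_space "noise_law N \<sigma>" by (rule prob_space_noise_law) fact
    define \<tau> where "\<tau> = \<sigma>\<^sup>2 / (real N * (R_of N \<theta>)\<^sup>2)"
    have \<tau>: "0 < \<tau>" using N R \<sigma> by (simp add: \<tau>_def)
    have "(\<sigma> / (R_of N \<theta> * sqrt (real N)))\<^sup>2 \<le> d\<^sup>2"
      using s \<sigma> R by (intro power_mono) auto
    then have \<tau>d: "\<tau> \<le> d\<^sup>2" by (simp add: \<tau>_def power_divide power_mult_distrib mult.commute)
    have \<sigma>d: "\<sigma>\<^sup>2 \<le> d\<^sup>2" using \<sigma> by (intro power_mono) auto
    have \<sigma>': "\<sigma> \<le> 1 / 2" using \<sigma> d by simp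
    define L where "L = linear_phase_error N \<theta>"
    define D where "D = 4000000 * d\<^sup>2 * \<tau>"
    let ?W = "phase_error N \<theta>"
    note lin = phase_error_linearization[OF N R \<sigma>(1) \<sigma>', folded L_def \<tau>_def]
    have "2000000 * (\<tau> + \<sigma>\<^sup>2) * \<tau> \<le> 2000000 * (d\<^sup>2 + d\<^sup>2) * \<tau>"
      using \<tau> \<tau>d \<sigma>d by (intro mult_right_mono mult_left_mono add_mono) auto
    then have WD: "expectation (\<lambda>\<epsilon>. (?W \<epsilon> - L \<epsilon>)\<^sup>2) \<le> D"
      using lin(6) by (simp add: D_def)
    have W2: "(?W \<epsilon>)\<^sup>2 \<le> pi\<^sup>2" for \<epsilon>
      using power_mono[OF abs_wrapped_error_le_pi abs_ge_zero, of _ _ 2] by (simp add: phase_error_def)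
    have iW2: "integrable (noise_law N \<sigma>) (\<lambda>\<epsilon>. (?W \<epsilon>)\<^sup>2)"
      using W2 lin(1) by (intro integrable_const_bound[where B="pi\<^sup>2"]) auto
    note iW = square_integrable_imp_integrable[OF lin(1) iW2]
    have lead: "arg_Z_mse_leading N \<theta> \<sigma> = \<tau> * q2_of N \<theta>"
      by (simp add: arg_Z_mse_leading_def \<tau>_def)
    have "\<bar>expectation (\<lambda>\<epsilon>. (?W \<epsilon>)\<^sup>2) - \<tau> * q2_of N \<theta>\<bar>
        \<le> (1 + 1 / (e / 2)) * D + e / 2 * (\<tau> * q2_of N \<theta>)"
      using second_moment_perturbation(1)[OF lin(1,2) iW2 lin(3,4) WD, of "e / 2"] e
      unfolding lin(5) by simp
    also have "(1 + 1 / (e / 2)) * D = K * d\<^sup>2 * \<tau>" by (simp add: K_def D_def)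
    also have "\<dots> \<le> e / 4 * \<tau>" using Kd \<tau> by (intro mult_right_mono) auto
    also have "e / 2 * (\<tau> * q2_of N \<theta>) \<le> e / 2 * \<tau>"
      using q2_le_one[OF N R] \<tau> e by (intro mult_left_mono mult_left_le) auto
    finally have 1: "\<bar>expectation (\<lambda>\<epsilon>. (?W \<epsilon>)\<^sup>2) - \<tau> * q2_of N \<theta>\<bar> \<le> e / 4 * \<tau> + e / 2 * \<tau>"
      by simp
    have "(expectation ?W)\<^sup>2 \<le> D"
      using second_moment_perturbation(2)[OF lin(1,2) iW2 lin(3,4) WD, of "e / 2"] e by simp
    also have "D \<le> K * d\<^sup>2 * \<tau>"
      unfolding D_def using K \<tau> by (intro mult_right_mono) auto
    also have "\<dots> \<le> e / 4 * \<tau>" using Kd \<tau> by (intro mult_right_mono) auto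
    finally have 2: "(expectation ?W)\<^sup>2 \<le> e / 4 * \<tau>" .
    have 3: "variance ?W = expectation (\<lambda>\<epsilon>. (?W \<epsilon>)\<^sup>2) - (expectation ?W)\<^sup>2"
      using iW iW2 by (rule variance_eq)
    have \<tau>e: "0 < e * \<tau>" using \<tau> e by simp
    show "\<bar>expectation (\<lambda>\<epsilon>. (?W \<epsilon>)\<^sup>2) - arg_Z_mse_leading N \<theta> \<sigma>\<bar>
        \<le> e * (\<sigma>\<^sup>2 / (real N * (R_of N \<theta>)\<^sup>2))"
      unfolding lead \<tau>_def[symmetric] using 1 \<tau>e by linarith
    show "\<bar>variance ?W - arg_Z_mse_leading N \<theta> \<sigma>\<bar> \<le> e * (\<sigma>\<^sup>2 / (real N * (R_of N \<theta>)\<^sup>2))"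
      unfolding lead \<tau>_def[symmetric] 3 using 1 2 \<tau>e zero_le_power2[of "expectation ?W"] by linarith
  qed (use d in auto)
qed


section \<open>Transfer to the observation law and efficiency of both estimators\<close>

lemma integral_wrapped_error_observation_law:
  fixes F :: "real \<Rightarrow> real"
  assumes "F \<in> borel_measurable borel"
  shows "(\<integral>x. F (wrapped_error (Arg (order_parameter N (\<lambda>j. x j - b j))) \<alpha>) \<partial>observation_law N \<theta>0 \<sigma> \<Psi>)
    = (\<integral>\<epsilon>. F (wrapped_error (Arg (order_parameter N (\<lambda>j. \<theta>0 j + \<Psi> - b j + \<epsilon> j))) \<alpha>) \<partial>noise_law N \<sigma>)"
proof -
  have "(\<integral>x. F (wrapped_error (Arg (order_parameter N (\<lambda>j. x j - b j))) \<alpha>) \<partial>observation_law N \<theta>0 \<sigma> \<Psi>)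
      = (\<integral>\<epsilon>. F (wrapped_error (Arg (order_parameter N (\<lambda>j. observation N \<theta>0 \<Psi> \<epsilon> j - b j))) \<alpha>) \<partial>noise_law N \<sigma>)"
    unfolding observation_law_def
    by (intro integral_distr measurable_observation measurable_compose[OF measurable_wrapped_error_Arg assms]
        borel_measurable_diff measurable_lborel_coordinate borel_measurable_const)
  \<comment> \<open>Only indices below \<open>N\<close> enter the order parameter, so the
    restriction in \<open>observation\<close> is invisible.\<close>
  moreover have "order_parameter N (\<lambda>j. observation N \<theta>0 \<Psi> \<epsilon> j - b j)
      = order_parameter N (\<lambda>j. \<theta>0 j + \<Psi> - b j + \<epsilon> j)" for \<epsilon>
    by (simp add: order_parameter_def observation_def algebra_simps)
  ultimately show ?thesis by simp
qed

lemma arg_Z_mse_eq: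
  "arg_Z_mse N \<theta>0 \<Psi> \<sigma> = (\<integral>\<epsilon>. (phase_error N (\<lambda>j. \<theta>0 j + \<Psi>) \<epsilon>)\<^sup>2 \<partial>noise_law N \<sigma>)"
  using integral_wrapped_error_observation_law[where F="\<lambda>x. x\<^sup>2" and b="\<lambda>_. 0"]
  by (simp add: arg_Z_mse_def wrapped_mse_def phase_error_def)

lemma order_parameter_const: "1 \<le> N \<Longrightarrow> order_parameter N (\<lambda>_. a) = cis a"
  by (simp add: order_parameter_def)

lemma cis_Arg_cis: "cis (Arg (cis a)) = cis a"
  by (simp add: cis_Arg sgn_eq)

text \<open>Subtracting the template turns the full estimator into \<open>arg Z\<close> for a fully aligned configuration.\<close>

lemma wrapped_error_full_estimator:
  assumes "1 \<le> N"
  shows "wrapped_error (Arg (order_parameter N (\<lambda>j. \<Psi> + \<epsilon> j))) \<Psi> = phase_error N (\<lambda>_. \<Psi>) \<epsilon>"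
  by (simp add: phase_error_def wrapped_error_def order_parameter_const[OF assms] cis_divide[symmetric] cis_Arg_cis)

text \<open>A general \<open>F\<close> is kept because the variance needs the identity, for the
  mean, and then a shifted square.\<close>

lemma integral_full_estimator:
  fixes F :: "real \<Rightarrow> real"
  assumes "1 \<le> N" "F \<in> borel_measurable borel"
  shows "(\<integral>x. F (wrapped_error (full_estimator N \<theta>0 x) \<Psi>) \<partial>observation_law N \<theta>0 \<sigma> \<Psi>)
    = (\<integral>\<epsilon>. F (phase_error N (\<lambda>_. \<Psi>) \<epsilon>) \<partial>noise_law N \<sigma>)"
  using integral_wrapped_error_observation_law[OF assms(2), of N \<theta>0 \<sigma> \<Psi> \<theta>0 \<Psi>]
  by (simp add: full_estimator_def wrapped_error_full_estimator[OF assms(1)])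

text \<open>For an aligned configuration \<open>R = 1\<close>, and
  \<open>R^2 \<le> q2 \<le> 1\<close> forces \<open>q2 = 1\<close>, so the leading term is the
  Cramer-Rao value.\<close>

lemma aligned_leading:
  assumes "1 \<le> N"
  shows R_of_const: "R_of N (\<lambda>_. a) = 1"
    and arg_Z_mse_leading_const: "arg_Z_mse_leading N (\<lambda>_. a) \<sigma> = \<sigma>\<^sup>2 / real N"
proof -
  show R: "R_of N (\<lambda>_. a) = 1" by (simp add: R_of_def order_parameter_const[OF assms])
  have "q2_of N (\<lambda>_. a) = 1"
    using R_square_le_q2[OF assms, of "\<lambda>_. a"] q2_le_one[OF assms, of "\<lambda>_. a"] R by simp
  then show "arg_Z_mse_leading N (\<lambda>_. a) \<sigma> = \<sigma>\<^sup>2 / real N"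
    by (simp add: arg_Z_mse_leading_def R)
qed

text \<open>Alignment gives \<open>R = 1\<close>, so the second smallness condition follows from
  \<open>\<sigma> < d\<close> and the threshold is uniform over all templates.\<close>

lemma full_estimator_asymptotics:
  assumes "0 < e"
  shows "\<exists>d>0. \<forall>(N::nat) (\<theta>0 :: nat \<Rightarrow> real) (\<Psi>::real) (\<sigma>::real).
        1 \<le> N \<longrightarrow> 0 < \<sigma> \<longrightarrow> \<sigma> < d \<longrightarrow>
        \<bar>wrapped_mse (observation_law N \<theta>0 \<sigma> \<Psi>) (full_estimator N \<theta>0) \<Psi> - \<sigma>\<^sup>2 / real N\<bar>
          \<le> e * (\<sigma>\<^sup>2 / real N) \<and>
        \<bar>wrapped_variance (observation_law N \<theta>0 \<sigma> \<Psi>) (full_estimator N \<theta>0) \<Psi> - \<sigma>\<^sup>2 / real N\<bar>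
          \<le> e * (\<sigma>\<^sup>2 / real N)"
proof -
  obtain d where d: "0 < d" and *: "\<And>N \<theta> \<sigma>. 1 \<le> N \<Longrightarrow> 0 < R_of N \<theta> \<Longrightarrow> 0 < \<sigma> \<Longrightarrow> \<sigma> < d \<Longrightarrow>
      \<sigma> / (R_of N \<theta> * sqrt (real N)) < d \<Longrightarrow>
      \<bar>(\<integral>\<epsilon>. (phase_error N \<theta> \<epsilon>)\<^sup>2 \<partial>noise_law N \<sigma>) - arg_Z_mse_leading N \<theta> \<sigma>\<bar>
        \<le> e * (\<sigma>\<^sup>2 / (real N * (R_of N \<theta>)\<^sup>2)) \<and>
      \<bar>prob_space.variance (noise_law N \<sigma>) (phase_error N \<theta>) - arg_Z_mse_leading N \<theta> \<sigma>\<bar>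
        \<le> e * (\<sigma>\<^sup>2 / (real N * (R_of N \<theta>)\<^sup>2))"
    using phase_error_asymptotics[OF assms] by blast
  show ?thesis
  proof (intro exI[of _ d] conjI[OF d] allI impI)
    fix N :: nat and \<theta>0 :: "nat \<Rightarrow> real" and \<Psi> \<sigma> :: real
    assume N: "1 \<le> N" and \<sigma>: "0 < \<sigma>" "\<sigma> < d"
    have "\<sigma> / sqrt (real N) \<le> \<sigma>" using N \<sigma> by (simp add: divide_le_eq)
    then have "\<sigma> / sqrt (real N) < d" using \<sigma> by simp
    moreover have "wrapped_mse (observation_law N \<theta>0 \<sigma> \<Psi>) (full_estimator N \<theta>0) \<Psi>
        = (\<integral>\<epsilon>. (phase_error N (\<lambda>_. \<Psi>) \<epsilon>)\<^sup>2 \<partial>noise_law N \<sigma>)"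
      unfolding wrapped_mse_def by (rule integral_full_estimator[OF N]) simp
    moreover have "wrapped_variance (observation_law N \<theta>0 \<sigma> \<Psi>) (full_estimator N \<theta>0) \<Psi>
        = prob_space.variance (noise_law N \<sigma>) (phase_error N (\<lambda>_. \<Psi>))"
      unfolding wrapped_variance_def integral_full_estimator[OF N, of "\<lambda>x. x", simplified]
      by (rule integral_full_estimator[OF N, of "\<lambda>x. (x - _)\<^sup>2"]) simp
    ultimately show "\<bar>wrapped_mse (observation_law N \<theta>0 \<sigma> \<Psi>) (full_estimator N \<theta>0) \<Psi> - \<sigma>\<^sup>2 / real N\<bar>
          \<le> e * (\<sigma>\<^sup>2 / real N) \<and>
        \<bar>wrapped_variance (observation_law N \<theta>0 \<sigma> \<Psi>) (full_estimator N \<theta>0) \<Psi> - \<sigma>\<^sup>2 / real N\<bar>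
          \<le> e * (\<sigma>\<^sup>2 / real N)"
      using *[OF N _ \<sigma>, of "\<lambda>_. \<Psi>"] by (simp add: aligned_leading[OF N])
  qed
qed

lemma arg_Z_mse_asymptotics:
  assumes "0 < e"
  shows "\<exists>d>0. \<forall>(N::nat) (\<theta>0 :: nat \<Rightarrow> real) (\<Psi>::real) (\<sigma>::real).
        let \<theta> = (\<lambda>j. \<theta>0 j + \<Psi>); R = R_of N \<theta> in
        1 \<le> N \<longrightarrow> 0 < R \<longrightarrow> 0 < \<sigma> \<longrightarrow> \<sigma> < d \<longrightarrow> \<sigma> / (R * sqrt (real N)) < d \<longrightarrow>
        \<bar>arg_Z_mse N \<theta>0 \<Psi> \<sigma> - arg_Z_mse_leading N \<theta> \<sigma>\<bar> \<le> e * (\<sigma>\<^sup>2 / (real N * R\<^sup>2))"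
  using phase_error_asymptotics[OF assms] unfolding arg_Z_mse_eq Let_def by blast

text \<open>For a fixed configuration the tolerance may depend on \<open>q2 > 0\<close>: taking
  \<open>e / 2 * q2\<close> turns an error relative to \<open>\<sigma>^2 / (N R^2)\<close> into one
  relative to the leading term.\<close>

lemma arg_Z_mse_ratio:
  fixes \<theta>0 :: "nat \<Rightarrow> real" and \<Psi> :: real
  defines "\<theta> \<equiv> \<lambda>j. \<theta>0 j + \<Psi>"
  assumes N: "1 \<le> N" and R: "0 < R_of N \<theta>"
  shows "((\<lambda>\<sigma>. arg_Z_mse N \<theta>0 \<Psi> \<sigma> / arg_Z_mse_leading N \<theta> \<sigma>) \<longlongrightarrow> 1) (at_right 0)"
proof (rule tendstoI)
  fix e :: real assume e: "0 < e"
  let ?q = "q2_of N \<theta>" and ?R = "R_of N \<theta>"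
  have q: "0 < ?q" by (rule q2_pos[OF N R])
  obtain d where d: "0 < d" and *: "\<And>\<sigma>. 0 < \<sigma> \<Longrightarrow> \<sigma> < d \<Longrightarrow> \<sigma> / (?R * sqrt (real N)) < d \<Longrightarrow>
      \<bar>arg_Z_mse N \<theta>0 \<Psi> \<sigma> - arg_Z_mse_leading N \<theta> \<sigma>\<bar> \<le> (e / 2 * ?q) * (\<sigma>\<^sup>2 / (real N * ?R\<^sup>2))"
    using arg_Z_mse_asymptotics[of "e / 2 * ?q"] e q N R unfolding Let_def \<theta>_def by fastforce
  have RN: "0 < ?R * sqrt (real N)" using N R by simp
  have "\<forall>\<^sub>F \<sigma> in at_right 0. \<sigma> \<in> {0<..<min d (d * (?R * sqrt (real N)))}"
    using d RN by (intro eventually_at_right_real) simp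
  then show "\<forall>\<^sub>F \<sigma> in at_right 0. dist (arg_Z_mse N \<theta>0 \<Psi> \<sigma> / arg_Z_mse_leading N \<theta> \<sigma>) 1 < e"
  proof eventually_elim
    case (elim \<sigma>)
    have \<sigma>: "0 < \<sigma>" "\<sigma> < d" "\<sigma> / (?R * sqrt (real N)) < d"
      using elim RN by (auto simp: divide_less_eq)
    let ?l = "arg_Z_mse_leading N \<theta> \<sigma>"
    have l: "?l = ?q * (\<sigma>\<^sup>2 / (real N * ?R\<^sup>2))" by (simp add: arg_Z_mse_leading_def)
    have l0: "0 < ?l" unfolding l using q \<sigma> N R by simp
    have "\<bar>arg_Z_mse N \<theta>0 \<Psi> \<sigma> - ?l\<bar> \<le> e / 2 * ?l"
      using *[OF \<sigma>] unfolding l by (simp only: mult.assoc)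
    also have "\<dots> < e * ?l" using e l0 by simp
    finally have "\<bar>arg_Z_mse N \<theta>0 \<Psi> \<sigma> - ?l\<bar> / ?l < e" using l0 by (simp add: divide_less_eq)
    moreover have "arg_Z_mse N \<theta>0 \<Psi> \<sigma> / ?l - 1 = (arg_Z_mse N \<theta>0 \<Psi> \<sigma> - ?l) / ?l"
      using l0 by (simp add: diff_divide_distrib)
    ultimately show ?case using l0 by (simp add: dist_real_def)
  qed
qed

lemma arg_Z_efficiency_eq:
  assumes "1 \<le> N" "0 < R_of N \<theta>" "0 < \<sigma>"
  shows "arg_Z_efficiency N \<theta> \<sigma> = (R_of N \<theta>)\<^sup>2 / q2_of N \<theta>"
  using assms by (simp add: arg_Z_efficiency_def arg_Z_mse_leading_def field_simps)

text \<open>The true ratio is the constant leading-order efficiency divided by a quantity tending to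
  1.\<close>

lemma arg_Z_efficiency_limit:
  fixes \<theta>0 :: "nat \<Rightarrow> real" and \<Psi> :: real
  defines "\<theta> \<equiv> \<lambda>j. \<theta>0 j + \<Psi>"
  assumes N: "1 \<le> N" and R: "0 < R_of N \<theta>"
  shows "((\<lambda>\<sigma>. (\<sigma>\<^sup>2 / real N) / arg_Z_mse N \<theta>0 \<Psi> \<sigma>) \<longlongrightarrow> (R_of N \<theta>)\<^sup>2 / q2_of N \<theta>) (at_right 0)"
proof -
  define r where "r = (\<lambda>\<sigma>. arg_Z_mse N \<theta>0 \<Psi> \<sigma> / arg_Z_mse_leading N \<theta> \<sigma>)"
  have lim: "((\<lambda>\<sigma>. (R_of N \<theta>)\<^sup>2 / q2_of N \<theta> / r \<sigma>) \<longlongrightarrow> (R_of N \<theta>)\<^sup>2 / q2_of N \<theta> / 1) (at_right 0)"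
    using arg_Z_mse_ratio[OF N R[unfolded \<theta>_def]] unfolding r_def \<theta>_def by (intro tendsto_intros) auto
  have ev: "\<forall>\<^sub>F \<sigma> in at_right 0.
      (R_of N \<theta>)\<^sup>2 / q2_of N \<theta> / r \<sigma> = (\<sigma>\<^sup>2 / real N) / arg_Z_mse N \<theta>0 \<Psi> \<sigma>"
    using eventually_at_right_less[of "0::real"]
  proof eventually_elim
    case (elim \<sigma>)
    have "arg_Z_mse_leading N \<theta> \<sigma> \<noteq> 0"
      using elim N R q2_pos[OF N R] by (simp add: arg_Z_mse_leading_def)
    then show ?case
      unfolding arg_Z_efficiency_eq[OF N R elim, symmetric] arg_Z_efficiency_def r_def by simp
  qed
  show ?thesis using lim[THEN tendsto_cong[OF ev, THEN iffD1]] by simp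
qed

text \<open>Leading order appears in two forms: estimates uniform over all configurations in the
  small-error regime, and limits as \<sigma> tends to 0 for a fixed configuration. The latter tie
  the formal efficiency to the actual mean-squared error.\<close>

theorem proposition5:
  shows
    "(\<forall>(N::nat) (\<theta>0 :: nat \<Rightarrow> real) (\<Psi>::real) (\<sigma>::real). 1 \<le> N \<longrightarrow> 0 < \<sigma> \<longrightarrow>
        (\<forall>\<psi>. observation_law N \<theta>0 \<sigma> \<psi> =
               density (\<Pi>\<^sub>M j\<in>{..<N}. lborel) (\<lambda>x. ennreal (likelihood N \<theta>0 \<sigma> \<psi> x))) \<and>
        fisher_information (observation_law N \<theta>0 \<sigma>) (likelihood N \<theta>0 \<sigma>) \<Psi> = real N / \<sigma>\<^sup>2 \<and>
        (\<forall>T. unbiased_near (observation_law N \<theta>0 \<sigma>) T \<Psi> \<longrightarrow>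
             integrable (observation_law N \<theta>0 \<sigma> \<Psi>) (\<lambda>x. (T x)\<^sup>2) \<longrightarrow>
             prob_space.variance (observation_law N \<theta>0 \<sigma> \<Psi>) T \<ge> \<sigma>\<^sup>2 / real N))
     \<and>
     (\<forall>e>0. \<exists>d>0. \<forall>(N::nat) (\<theta>0 :: nat \<Rightarrow> real) (\<Psi>::real) (\<sigma>::real).
        1 \<le> N \<longrightarrow> 0 < \<sigma> \<longrightarrow> \<sigma> < d \<longrightarrow>
        \<bar>wrapped_mse (observation_law N \<theta>0 \<sigma> \<Psi>) (full_estimator N \<theta>0) \<Psi> - \<sigma>\<^sup>2 / real N\<bar>
          \<le> e * (\<sigma>\<^sup>2 / real N) \<and>
        \<bar>wrapped_variance (observation_law N \<theta>0 \<sigma> \<Psi>) (full_estimator N \<theta>0) \<Psi> - \<sigma>\<^sup>2 / real N\<bar>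
          \<le> e * (\<sigma>\<^sup>2 / real N))
     \<and>
     (\<forall>e>0. \<exists>d>0. \<forall>(N::nat) (\<theta>0 :: nat \<Rightarrow> real) (\<Psi>::real) (\<sigma>::real).
        let \<theta> = (\<lambda>j. \<theta>0 j + \<Psi>); R = R_of N \<theta> in
        1 \<le> N \<longrightarrow> 0 < R \<longrightarrow> 0 < \<sigma> \<longrightarrow> \<sigma> < d \<longrightarrow> \<sigma> / (R * sqrt (real N)) < d \<longrightarrow>
        \<bar>arg_Z_mse N \<theta>0 \<Psi> \<sigma> - arg_Z_mse_leading N \<theta> \<sigma>\<bar> \<le> e * (\<sigma>\<^sup>2 / (real N * R\<^sup>2)))
     \<and>
     (\<forall>(N::nat) (\<theta>0 :: nat \<Rightarrow> real) (\<Psi>::real).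
        let \<theta> = (\<lambda>j. \<theta>0 j + \<Psi>); R = R_of N \<theta>; q2 = q2_of N \<theta> in
        1 \<le> N \<longrightarrow> 0 < R \<longrightarrow>
        ((\<lambda>\<sigma>. arg_Z_mse N \<theta>0 \<Psi> \<sigma> / arg_Z_mse_leading N \<theta> \<sigma>) \<longlongrightarrow> 1) (at_right 0) \<and>
        ((\<lambda>\<sigma>. (\<sigma>\<^sup>2 / real N) / arg_Z_mse N \<theta>0 \<Psi> \<sigma>) \<longlongrightarrow> R\<^sup>2 / q2) (at_right 0) \<and>
        (\<forall>\<sigma>>0. arg_Z_efficiency N \<theta> \<sigma> = R\<^sup>2 / q2) \<and>
        R\<^sup>2 / q2 \<le> 1)"
proof (intro conjI allI impI, goal_cases)
  case (1 N \<theta>0 \<Psi> \<sigma> \<psi>)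
  then show ?case by (rule observation_law_eq_density)
next
  case (2 N \<theta>0 \<Psi> \<sigma>)
  then show ?case by (rule fisher_information_observation_law)
next
  case (3 N \<theta>0 \<Psi> \<sigma> T)
  then show ?case by (rule cramer_rao_observation_law)
next
  case (4 e)
  then show ?case by (rule full_estimator_asymptotics)
next
  case (5 e)
  then show ?case by (rule arg_Z_mse_asymptotics)
next
  case (6 N \<theta>0 \<Psi>)
  show ?case
    unfolding Let_def
  proof (intro impI conjI allI)
    assume N: "1 \<le> N" and R: "0 < R_of N (\<lambda>j. \<theta>0 j + \<Psi>)"
    let ?\<theta> = "\<lambda>j. \<theta>0 j + \<Psi>"
    show "((\<lambda>\<sigma>. arg_Z_mse N \<theta>0 \<Psi> \<sigma> / arg_Z_mse_leading N ?\<theta> \<sigma>) \<longlongrightarrow> 1) (at_right 0)"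
      by (rule arg_Z_mse_ratio[OF N R])
    show "((\<lambda>\<sigma>. (\<sigma>\<^sup>2 / real N) / arg_Z_mse N \<theta>0 \<Psi> \<sigma>) \<longlongrightarrow> (R_of N ?\<theta>)\<^sup>2 / q2_of N ?\<theta>) (at_right 0)"
      by (rule arg_Z_efficiency_limit[OF N R])
    show "arg_Z_efficiency N ?\<theta> \<sigma> = (R_of N ?\<theta>)\<^sup>2 / q2_of N ?\<theta>" if "0 < \<sigma>" for \<sigma>
      by (rule arg_Z_efficiency_eq[OF N R that])
    show "(R_of N ?\<theta>)\<^sup>2 / q2_of N ?\<theta> \<le> 1"
      using R_square_le_q2[OF N R] q2_pos[OF N R] by (simp add: divide_le_eq_1)
  qed
qed

end
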